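(* For every real $p\ge 1$ there exists a finite constant $C(p)>0$, depending only on $p$, such that the following holds. Let $a>0$, let $(W,W')$ be an exchangeable pair of real random variables satisfying $$\mathbb{E}(W'\mid W)=(1-\tau)W+R$$ for some $0<\tau<1$ and some random variable $R=R(W)$ (a measurable function of $W$), and let $\Delta=W-W'$. Then for every $z\in\mathbb{R}$, $$|\mathbb{P}(W\le z)-\Phi(z)|\le \frac{C(p)\left(1+\mathbb{E}|W|^{2p}\right)}{(1+|z|)^p}\left(\sqrt{\mathbb{E}\left(1-\frac{1}{2\tau}\mathbb{E}(\Delta^2\mid W)\right)^2}+\frac{\sqrt{\mathbb{E}R^2}}{\tau}+a+\frac{a^3}{\tau}+\frac{\sqrt{\mathbb{E}\left[\Delta^4\mathbf{1}(|\Delta|>a)\right]}}{\tau}\right).$$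
   Context: A pair $(W,W')$ of random variables on a common probability space is an exchangeable pair if $(W,W')$ and $(W',W)$ have the same distribution. $\Phi(z)=\frac{1}{\sqrt{2\pi}}\int_{-\infty}^z e^{-t^2/2}\,dt$ is the standard normal distribution function. $\mathbf{1}(\cdot)$ denotes an indicator. The moments on the right-hand side are allowed to be $+\infty$, in which case the bound is trivial. *)

theory Defs
  imports "HOL-Probability.Probability"
begin

definition exchangeable_pair :: "'a measure \<Rightarrow> ('a \<Rightarrow> real) \<Rightarrow> ('a \<Rightarrow> real) \<Rightarrow> bool" where
  "exchangeable_pair M W W' \<longleftrightarrow>
     W \<in> borel_measurable M \<and> W' \<in> borel_measurable M \<and>
     distr M (borel \<Otimes>\<^sub>M borel) (\<lambda>\<omega>. (W \<omega>, W' \<omega>)) = distr M (borel \<Otimes>\<^sub>M borel) (\<lambda>\<omega>. (W' \<omega>, W \<omega>))"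

definition cond_exp_given :: "'a measure \<Rightarrow> ('a \<Rightarrow> real) \<Rightarrow> ('a \<Rightarrow> real) \<Rightarrow> 'a \<Rightarrow> real" where
  "cond_exp_given M W X = real_cond_exp M (vimage_algebra (space M) W borel) X"

definition ennreal_sqrt :: "ennreal \<Rightarrow> ennreal" where
  "ennreal_sqrt x = (if x = \<top> then \<top> else ennreal (sqrt (enn2real x)))"

text \<open>
  All moments are integrals with values in \<open>[0, \<infinity>]\<close>, so the right-hand side may be infinite. The
  function \<^const>\<open>real_cond_exp\<close> is the conditional expectation only where the latter exists. This
  is harmless: \<open>\<Delta>\<^sup>2\<close> is integrable as soon as \<open>E |W|\<^sup>2\<^sup>p < \<infinity>\<close>, since \<open>p \<ge> 1\<close> and \<open>W'\<close> is
  distributed like \<open>W\<close>; otherwise the bound is infinite because \<open>a > 0\<close> keeps the last factor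
  positive, whatever value \<^const>\<open>real_cond_exp\<close> takes. For the same reason the integrability of
  \<open>W'\<close> that is implicit in \<open>E(W' | W)\<close> need not be assumed.
\<close>

definition exchangeable_bound ::
  "'a measure \<Rightarrow> real \<Rightarrow> real \<Rightarrow> real \<Rightarrow> ('a \<Rightarrow> real) \<Rightarrow> ('a \<Rightarrow> real) \<Rightarrow> ('a \<Rightarrow> real) \<Rightarrow> real \<Rightarrow> real \<Rightarrow> ennreal" where
  "exchangeable_bound M C p \<tau> W W' R a z =
     (let \<Delta> = (\<lambda>\<omega>. W \<omega> - W' \<omega>) in
      ennreal C * (1 + (\<integral>\<^sup>+\<omega>. ennreal (\<bar>W \<omega>\<bar> powr (2 * p)) \<partial>M)) / ennreal ((1 + \<bar>z\<bar>) powr p) *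
      (ennreal_sqrt (\<integral>\<^sup>+\<omega>. ennreal ((1 - 1 / (2 * \<tau>) * cond_exp_given M W (\<lambda>\<omega>. (\<Delta> \<omega>)\<^sup>2) \<omega>)\<^sup>2) \<partial>M)
       + ennreal_sqrt (\<integral>\<^sup>+\<omega>. ennreal ((R \<omega>)\<^sup>2) \<partial>M) / ennreal \<tau>
       + ennreal a + ennreal (a ^ 3 / \<tau>)
       + ennreal_sqrt (\<integral>\<^sup>+\<omega>. ennreal ((\<Delta> \<omega>) ^ 4 * indicator {\<omega>. \<bar>\<Delta> \<omega>\<bar> > a} \<omega>) \<partial>M) / ennreal \<tau>))"

definition nonuniform_bound_on :: "real \<Rightarrow> real \<Rightarrow> 'a measure \<Rightarrow> bool" where
  "nonuniform_bound_on p C M \<longleftrightarrow>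
     (\<forall>W W' R r \<tau> a z.
        prob_space M \<longrightarrow>
        a > 0 \<longrightarrow>
        exchangeable_pair M W W' \<longrightarrow>
        0 < \<tau> \<longrightarrow> \<tau> < 1 \<longrightarrow>
        r \<in> borel_measurable borel \<longrightarrow> R = (\<lambda>\<omega>. r (W \<omega>)) \<longrightarrow>
        (AE \<omega> in M. cond_exp_given M W W' \<omega> = (1 - \<tau>) * W \<omega> + R \<omega>) \<longrightarrow>
        ennreal \<bar>measure M {\<omega> \<in> space M. W \<omega> \<le> z} - cdf std_normal_distribution z\<bar>
          \<le> exchangeable_bound M C p \<tau> W W' R a z)"

text \<open>
  The constant may depend on \<open>p\<close> only, in particular not on the type of the sample space, over
  which one cannot quantify inside a formula. Therefore the claim about \<open>C\<close> has two parts: some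
  \<open>C > 0\<close> works for all pairs on all probability spaces over \<^typ>\<open>real \<times> real\<close>, and every
  \<open>C > 0\<close> that does works for all pairs on all probability spaces over an arbitrary type \<open>'a\<close>.
  Together they imply \<open>\<exists>C>0. \<forall>M :: 'a measure. nonuniform_bound_on p C M\<close>, with one \<open>C\<close> for
  all types \<open>'a\<close>.
\<close>

definition universal_constant :: "real \<Rightarrow> real \<Rightarrow> bool" where
  "universal_constant p C \<longleftrightarrow>
     C > 0 \<and> (\<forall>N :: (real \<times> real) measure. nonuniform_bound_on p C N)"

end

theory Submission
  imports Defs
begin

text \<open>
  The proof is Stein's method with bounds that carry polynomial weights. Fix \<open>z\<close>, write
  \<open>B w = ((1 + \<bar>w\<bar>) / (1 + \<bar>z\<bar>)) powr p\<close> for the weight (\<open>growth p z w\<close> below), \<open>\<Delta> = W - W'\<close>, and let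
  \<open>f\<close> be the bounded solution of \<open>f' w - w * f w = 1(w \<le> z) - \<Phi> z\<close>. There is a \<open>K\<close> depending on \<open>p\<close>
  only such that \<open>(1 + \<bar>w\<bar>) * f w \<le> K * B w\<close> and \<open>\<bar>f' w\<bar> \<le> 2 * K * B w\<close> (\<open>stein_sol_le\<close>,
  \<open>stein_deriv_le\<close>): where \<open>B w < 1\<close>, that is \<open>\<bar>w\<bar> < \<bar>z\<bar>\<close>, the left sides are at most of the order of a Gaussian
  factor, which is smaller than any power of \<open>(1 + \<bar>w\<bar>) / (1 + \<bar>z\<bar>)\<close> up to a constant, and elsewhere
  they are bounded. Since
  \<open>\<parallel>B W\<parallel>\<^sub>2 \<le> (1 + \<bar>z\<bar>) powr - p * m\<close> with \<open>m = E (1 + \<bar>W\<bar>) powr (2 * p)\<close>, the Cauchy-Schwarz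
  inequality gains the factor \<open>(1 + \<bar>z\<bar>) powr - p\<close> wherever the proof of the uniform bound uses
  suprema of \<open>f\<close> and \<open>f'\<close>; the moment of order \<open>2 * p\<close> is the price.
  
  Exchangeability and the regression property give \<open>E \<Delta> (h W - h W') = 2 E h W (\<tau> W - R)\<close> for
  every \<open>h\<close> bounded by a multiple of \<open>B\<close> (\<open>stein_identity\<close>). With \<open>h = f\<close>,
  \<open>P(W \<le> z) - \<Phi> z = E f' W (1 - E(\<Delta>\<^sup>2 | W) / 2\<tau>) - E T / 2\<tau> - E R f W / \<tau>\<close>,
  where \<open>T = \<Delta> (f W - f W') - \<Delta>\<^sup>2 f' W\<close> is a Taylor remainder. The first and the last
  expectation are estimated by Cauchy-Schwarz. So is the part of \<open>T\<close> on \<open>\<bar>\<Delta>\<bar> > a\<close>, where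
  \<open>\<bar>T\<bar> \<le> 4 K \<Delta>\<^sup>2 (B W + B W')\<close> (\<open>stein_remainder_le\<close>). On \<open>\<bar>\<Delta>\<bar> \<le> a\<close> the derivative
  \<open>f' w = w * f w + 1(w \<le> z) - \<Phi> z\<close> is split (\<open>stein_remainder_le_small\<close>): the locally Lipschitz part
  \<open>w * f w\<close> contributes a multiple of \<open>a\<^sup>3 (1 + \<bar>W\<bar>) B W\<close>, the jump at most \<open>\<Delta>\<^sup>2 1(\<bar>W - z\<bar> \<le> a)\<close>.
  The expectation of the latter is of order \<open>a (\<tau> + \<parallel>R\<parallel>\<^sub>2)\<close>, with the same gain (\<open>concentration\<close>): it is dominated by the left side
  of the Stein identity for a ramp of height \<open>4 * a\<close>. The factor \<open>1 + \<bar>W\<bar>\<close> in two of these terms is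
  affordable since \<open>1 + p \<le> 2 * p\<close>. All of this needs \<open>a \<le> 1\<close>; for \<open>a > 1\<close> the pointwise bound
  \<open>\<bar>1(w \<le> z) - \<Phi> z\<bar> \<le> K * B w\<close> is enough (\<open>trivial_bound\<close>).
  
  Finally, both sides of the inequality depend on the joint law of \<open>(W, W')\<close> only, so a
  constant that works on the plane works on every probability space (\<open>nonuniform_bound_on_transfer\<close>).
\<close>

section \<open>The standard normal distribution function\<close>

abbreviation Phi :: "real \<Rightarrow> real" where
  "Phi \<equiv> cdf std_normal_distribution"

interpretation std_normal: real_distribution std_normal_distribution
  by (rule real_dist_normal_dist)

lemma Phi_diff:
  assumes "x \<le> y"
  shows "(std_normal_density has_integral (Phi y - Phi x)) {x..y}"
proof (cases "x = y")
  case False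
  have int: "set_integrable lborel {x..y} std_normal_density"
    unfolding set_integrable_def by (intro integrable_mult_indicator) auto
  have "Phi y - Phi x = measure std_normal_distribution {x<..y}"
    using assms False by (intro std_normal.cdf_diff_eq) auto
  also have "\<dots> = enn2real (\<integral>\<^sup>+t. ennreal (indicator {x<..y} t *\<^sub>R std_normal_density t) \<partial>lborel)"
    unfolding measure_def
    by (subst emeasure_density)
      (auto intro!: arg_cong[where f = enn2real] nn_integral_cong simp: indicator_def)
  also have "\<dots> = (LINT t:{x<..y}|lborel. std_normal_density t)"
    unfolding set_lebesgue_integral_def
    by (rule integral_eq_nn_integral[symmetric]) (auto intro!: AE_I2)
  also have "\<dots> = (LINT t:{x..y}|lborel. std_normal_density t)"
    unfolding set_lebesgue_integral_def
    by (intro integral_cong_AE) (auto intro!: eventually_mono[OF AE_lborel_singleton[of x]] simp: indicator_def)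
  finally show ?thesis
    using set_borel_integral_eq_integral[OF int] by (simp add: has_integral_integral)
qed auto

lemma continuous_std_normal_density [continuous_intros]:
  "continuous_on A f \<Longrightarrow> continuous_on A (\<lambda>x. std_normal_density (f x))"
  unfolding std_normal_density_def by (intro continuous_intros) auto

lemma has_real_derivative_Phi:
  "(Phi has_real_derivative std_normal_density x) (at x)"
proof -
  have "((\<lambda>u. integral {x - 1..u} std_normal_density) has_real_derivative std_normal_density x)
          (at x within {x - 1..x + 1})"
    by (intro integral_has_real_derivative continuous_intros) auto
  hence "((\<lambda>u. integral {x - 1..u} std_normal_density) has_real_derivative std_normal_density x) (at x)"
    by (simp add: at_within_interior[of x "{x - 1..x + 1}"])
  hence "((\<lambda>u. integral {x - 1..u} std_normal_density + Phi (x - 1)) has_real_derivative std_normal_density x) (at x)"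
    by (auto intro!: derivative_eq_intros)
  moreover have "eventually (\<lambda>u. integral {x - 1..u} std_normal_density + Phi (x - 1) = Phi u) (nhds x)"
    by (rule eventually_mono[OF eventually_nhds_in_open[of "{x - 1<..}"]])
      (use integral_unique[OF Phi_diff] in auto)
  ultimately show ?thesis
    by (subst (asm) DERIV_cong_ev) auto
qed

lemma has_real_derivative_std_normal_density:
  "(std_normal_density has_real_derivative - x * std_normal_density x) (at x)"
proof -
  have "((\<lambda>x. 1 / sqrt (2 * pi) * exp (- x\<^sup>2 / 2)) has_real_derivative
      1 / sqrt (2 * pi) * (exp (- x\<^sup>2 / 2) * (- x))) (at x)"
    by (rule DERIV_cmult) (auto intro!: derivative_eq_intros)
  thus ?thesis
    unfolding std_normal_density_def[abs_def] by (simp add: mult_ac)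
qed

lemmas Phi_DERIV [derivative_intros] = DERIV_chain2[OF has_real_derivative_Phi]

lemma std_normal_density_minus [simp]: "std_normal_density (- x) = std_normal_density x"
  by (simp add: std_normal_density_def)

lemma std_normal_density_abs [simp]: "std_normal_density \<bar>x\<bar> = std_normal_density x"
  by (simp add: std_normal_density_def)

lemma std_normal_density_gt_0: "std_normal_density x > 0"
  by (simp add: normal_density_pos)

lemma std_normal_density_le_exp: "std_normal_density x \<le> exp (- x\<^sup>2 / 2)"
proof -
  have "1 / sqrt (2 * pi) \<le> 1"
    using pi_gt3 by (simp add: field_simps)
  thus ?thesis
    unfolding std_normal_density_def by (intro mult_left_le_one_le) auto
qed

lemma Phi_minus: "Phi (- x) = 1 - Phi x"
proof -
  have "((\<lambda>x. Phi x + Phi (- x)) has_real_derivative 0) (at x)" for x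
    by (auto intro!: derivative_eq_intros)
  hence "Phi y + Phi (- y) = Phi x + Phi (- x)" for y
    by (rule DERIV_isconst_all[rule_format])
  hence "(\<lambda>y. Phi y + Phi (- y)) = (\<lambda>y. Phi x + Phi (- x))" by blast
  moreover have "((\<lambda>y. Phi y + Phi (- y)) \<longlongrightarrow> 1 + 0) at_top"
    by (intro tendsto_add std_normal.cdf_lim_at_top_prob
        filterlim_compose[OF std_normal.cdf_lim_at_bot] filterlim_uminus_at_bot_at_top)
  ultimately have "((\<lambda>y. Phi x + Phi (- x)) \<longlongrightarrow> 1) (at_top :: real filter)"
    by simp
  thus ?thesis
    by (simp add: tendsto_const_iff)
qed

lemma Phi_nonneg: "0 \<le> Phi x" and Phi_le_1: "Phi x \<le> 1"
  by (simp_all add: std_normal.cdf_nonneg std_normal.cdf_bounded_prob)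

text \<open>
  The constant \<open>4 / 3\<close> is the smallest for which the difference of the two sides, divided by
  \<open>1 + x\<close>, is decreasing on all of \<open>[0, \<infinity>)\<close>. As this quotient tends to \<open>0\<close>, it is nonnegative.
\<close>

lemma normal_tail_le:
  assumes "x \<ge> 0"
  shows "(1 + x) * (1 - Phi x) \<le> 4 / 3 * std_normal_density x"
proof -
  define D where "D = (\<lambda>x. 4 / 3 * std_normal_density x / (1 + x) - (1 - Phi x))"
  have D': "(D has_real_derivative
      std_normal_density y * (1 - 4 / 3 * ((y\<^sup>2 + y + 1) / (1 + y)\<^sup>2))) (at y)" if "y \<ge> 0" for y
  proof -
    have "(D has_real_derivative (4 / 3 * (- y * std_normal_density y) * (1 + y) -
        4 / 3 * std_normal_density y * 1) / ((1 + y) * (1 + y)) - (0 - std_normal_density y)) (at y)"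
      unfolding D_def using that
      by (intro DERIV_diff DERIV_divide DERIV_cmult DERIV_const has_real_derivative_Phi
            has_real_derivative_std_normal_density) (auto intro!: derivative_eq_intros)
    also have "(4 / 3 * (- y * std_normal_density y) * (1 + y) -
        4 / 3 * std_normal_density y * 1) / ((1 + y) * (1 + y)) - (0 - std_normal_density y) =
        std_normal_density y * (1 - 4 / 3 * ((y\<^sup>2 + y + 1) / (1 + y)\<^sup>2))"
      using that by (simp add: divide_simps power2_eq_square) (simp add: algebra_simps)
    finally show ?thesis .
  qed
  have dec: "D v \<le> D u" if "0 \<le> u" "u \<le> v" for u v
  proof (rule DERIV_nonpos_imp_nonincreasing[OF that(2)])
    fix y assume y: "u \<le> y" "y \<le> v"
    have "3 * (1 + y)\<^sup>2 + (1 - y)\<^sup>2 = 4 * (y\<^sup>2 + y + 1)"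
      by (simp add: power2_eq_square algebra_simps)
    hence "3 * (1 + y)\<^sup>2 \<le> 4 * (y\<^sup>2 + y + 1)"
      by (metis le_add_same_cancel1 zero_le_power2)
    hence "1 - 4 / 3 * ((y\<^sup>2 + y + 1) / (1 + y)\<^sup>2) \<le> 0"
      using that y by (simp add: field_simps)
    thus "\<exists>D'. DERIV D y :> D' \<and> D' \<le> 0"
      using D'[of y] mult_nonneg_nonpos[OF normal_density_nonneg[of 0 1 y]] that y by force
  qed
  have "(D \<longlongrightarrow> 4 / 3 * 0 - (1 - 1)) at_top"
  proof -
    have "((\<lambda>x. std_normal_density x / (1 + x)) \<longlongrightarrow> 0) at_top"
    proof (rule Lim_null_comparison)
      show "eventually (\<lambda>x. norm (std_normal_density x / (1 + x)) \<le> 1 / x) at_top"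
        using eventually_gt_at_top[of 0]
      proof eventually_elim
        case (elim x)
        have "std_normal_density x \<le> 1"
          using std_normal_density_le_exp[of x] by (rule order_trans) simp
        hence "std_normal_density x / (1 + x) \<le> 1 / x"
          using elim by (intro frac_le) auto
        thus ?case using elim by simp
      qed
      show "((\<lambda>x. 1 / x) \<longlongrightarrow> (0::real)) at_top"
        by (simp add: tendsto_inverse_0_at_top filterlim_ident divide_inverse)
    qed
    thus ?thesis
      unfolding D_def times_divide_eq_right[symmetric]
      by (intro tendsto_intros std_normal.cdf_lim_at_top_prob)
  qed
  moreover have "eventually (\<lambda>y. D y \<le> D x) at_top"
    using eventually_ge_at_top[of x] by eventually_elim (use assms dec in auto)
  ultimately have "0 \<le> D x"
    using tendsto_upperbound[of D 0 at_top "D x"] by simp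
  thus ?thesis
    using assms by (simp add: D_def field_simps)
qed

section \<open>Polynomially weighted bounds for the Stein equation\<close>

lemma powr_one_plus_le_gauss:
  fixes p t :: real
  assumes "p \<ge> 0" "t \<ge> 0"
  shows "(1 + t) powr p \<le> exp (p\<^sup>2 / 2) * exp (t\<^sup>2 / 2)"
proof -
  have "p * ln (1 + t) \<le> p * t"
    using assms ln_add_one_self_le_self by (intro mult_left_mono) auto
  also have "\<dots> \<le> p\<^sup>2 / 2 + t\<^sup>2 / 2"
    using sum_squares_ge_zero[of "p - t" 0] by (simp add: power2_eq_square algebra_simps)
  finally show ?thesis
    using assms by (simp add: powr_def flip: exp_add)
qed

text \<open>
  The weight is at least \<open>1\<close> where \<open>\<bar>w\<bar> \<ge> \<bar>z\<bar>\<close>, and its square has an expectation of order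
  \<open>(1 + \<bar>z\<bar>) powr (- 2 * p)\<close> under any law with a moment of order \<open>2 * p\<close>.
\<close>

definition growth :: "real \<Rightarrow> real \<Rightarrow> real \<Rightarrow> real" where
  "growth p z w = ((1 + \<bar>w\<bar>) / (1 + \<bar>z\<bar>)) powr p"

definition stein_rhs :: "real \<Rightarrow> real \<Rightarrow> real" where
  "stein_rhs z w = indicator {..z} w - Phi z"

text \<open>
  This is the bounded solution \<open>f\<close> of \<open>f' w - w * f w = stein_rhs z w\<close>. The minimum and the maximum
  merge the two branches \<open>\<Phi> w (1 - \<Phi> z) / \<phi> w\<close> for \<open>w \<le> z\<close> and \<open>\<Phi> z (1 - \<Phi> w) / \<phi> w\<close> for \<open>w \<ge> z\<close>,
  which makes the continuity at \<open>z\<close> and the symmetry under \<open>(z, w) \<mapsto> (- z, - w)\<close> evident.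
\<close>

definition stein_sol :: "real \<Rightarrow> real \<Rightarrow> real" where
  "stein_sol z w = Phi (min w z) * (1 - Phi (max w z)) / std_normal_density w"

text \<open>
  The factor \<open>exp (p\<^sup>2 / 2)\<close> bounds \<open>(1 + t) powr p * exp (- t\<^sup>2 / 2)\<close> for all \<open>t \<ge> 0\<close>; the factor \<open>2\<close> leaves
  room for \<open>(4 / 3)\<^sup>2\<close>, as some estimates use \<open>normal_tail_le\<close> twice.
\<close>

definition gauss_const :: "real \<Rightarrow> real" where
  "gauss_const p = 2 * exp (p\<^sup>2 / 2)"

lemma gauss_const_ge: "gauss_const p \<ge> 2"
  unfolding gauss_const_def by simp

lemma growth_nonneg: "growth p z w \<ge> 0"
  by (simp add: growth_def)

lemma growth_minus [simp]: "growth p (- z) w = growth p z w" "growth p z (- w) = growth p z w"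
  by (simp_all add: growth_def)

lemma growth_ge_1: "p \<ge> 0 \<Longrightarrow> \<bar>z\<bar> \<le> \<bar>w\<bar> \<Longrightarrow> growth p z w \<ge> 1"
  unfolding growth_def by (intro ge_one_powr_ge_zero) auto

lemma growth_mono: "p \<ge> 0 \<Longrightarrow> \<bar>v\<bar> \<le> \<bar>w\<bar> \<Longrightarrow> growth p z v \<le> growth p z w"
  unfolding growth_def by (intro powr_mono2 divide_right_mono) auto

text \<open>
  The Gaussian gain between \<open>w\<close> and \<open>z\<close> beats the loss of weight because
  \<open>z\<^sup>2 - w\<^sup>2 \<ge> (z - w)\<^sup>2\<close> and \<open>(1 + z) / (1 + w) \<le> 1 + (z - w)\<close>.
\<close>

lemma gauss_le_growth:
  assumes "p \<ge> 0" "0 \<le> w" "w \<le> z"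
  shows "exp (- (z\<^sup>2 - w\<^sup>2) / 2) \<le> exp (p\<^sup>2 / 2) * growth p z w"
proof -
  have "(1 + z) * 1 \<le> (1 + w) * (1 + (z - w))"
    using assms by (simp add: algebra_simps mult_left_mono)
  hence "((1 + z) / (1 + w)) powr p \<le> (1 + (z - w)) powr p"
    using assms by (intro powr_mono2) (auto simp: field_simps)
  also have "\<dots> \<le> exp (p\<^sup>2 / 2) * exp ((z - w)\<^sup>2 / 2)"
    using assms by (intro powr_one_plus_le_gauss) auto
  also have "\<dots> \<le> exp (p\<^sup>2 / 2) * exp ((z\<^sup>2 - w\<^sup>2) / 2)"
  proof -
    have "w * w \<le> w * z" using assms by (intro mult_left_mono) auto
    hence "(z - w)\<^sup>2 \<le> z\<^sup>2 - w\<^sup>2" by (simp add: power2_eq_square algebra_simps)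
    thus ?thesis by simp
  qed
  finally have *: "((1 + z) / (1 + w)) powr p \<le> exp (p\<^sup>2 / 2) * exp ((z\<^sup>2 - w\<^sup>2) / 2)" .
  have "1 = ((1 + z) / (1 + w)) powr p * growth p z w"
    using assms by (simp add: growth_def flip: powr_mult)
  also have "\<dots> \<le> exp (p\<^sup>2 / 2) * exp ((z\<^sup>2 - w\<^sup>2) / 2) * growth p z w"
    by (intro mult_right_mono * growth_nonneg)
  finally have "exp (- ((z\<^sup>2 - w\<^sup>2) / 2)) * 1 \<le> exp (- ((z\<^sup>2 - w\<^sup>2) / 2)) * (exp (p\<^sup>2 / 2) * exp ((z\<^sup>2 - w\<^sup>2) / 2) * growth p z w)"
    by (intro mult_left_mono) auto
  also have "\<dots> = exp (p\<^sup>2 / 2) * growth p z w"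
    by (simp add: exp_minus)
  finally show ?thesis by (simp add: minus_divide_left)
qed

lemma normal_tail_le_growth:
  assumes "p \<ge> 0" "z \<ge> 0"
  shows "4 / 3 * (1 - Phi z) \<le> gauss_const p * growth p z w"
proof -
  have "1 * (1 - Phi z) \<le> (1 + z) * (1 - Phi z)"
    using assms Phi_le_1[of z] by (intro mult_right_mono) auto
  also have "\<dots> \<le> 4 / 3 * exp (- z\<^sup>2 / 2)"
    using normal_tail_le[OF assms(2)] std_normal_density_le_exp[of z] by simp
  also have "exp (- z\<^sup>2 / 2) \<le> exp (p\<^sup>2 / 2) * growth p z 0"
    using gauss_le_growth[OF assms(1), of 0 z] assms by simp
  also have "\<dots> \<le> exp (p\<^sup>2 / 2) * growth p z w"
    using assms by (intro mult_left_mono growth_mono) auto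
  finally have "4 / 3 * (1 - Phi z) \<le> 16 / 9 * (exp (p\<^sup>2 / 2) * growth p z w)" by simp
  also have "\<dots> \<le> 2 * (exp (p\<^sup>2 / 2) * growth p z w)"
    by (intro mult_right_mono) (auto simp: growth_nonneg)
  finally show ?thesis by (simp add: gauss_const_def mult_ac)
qed

lemma stein_rhs_le:
  assumes "p \<ge> 0"
  shows "\<bar>stein_rhs z w\<bar> \<le> gauss_const p * growth p z w"
proof (cases "(w \<le> z \<and> z \<ge> 0) \<or> (z < w \<and> z < 0)")
  case True
  have "\<bar>stein_rhs z w\<bar> = 1 - Phi \<bar>z\<bar>"
    using True Phi_minus[of z] Phi_nonneg[of z] Phi_le_1[of z] by (auto simp: stein_rhs_def)
  thus ?thesis
    using normal_tail_le_growth[OF assms, of "\<bar>z\<bar>" w] Phi_le_1[of "\<bar>z\<bar>"] 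
    by (auto simp: growth_def)
next
  case False
  have "\<bar>stein_rhs z w\<bar> \<le> 1 * 1"
    using Phi_nonneg[of z] Phi_le_1[of z] by (auto simp: stein_rhs_def indicator_def)
  also have "\<dots> \<le> gauss_const p * growth p z w"
    using False assms gauss_const_ge[of p]
    by (intro mult_mono growth_ge_1) auto
  finally show ?thesis .
qed

lemma stein_sol_minus: "stein_sol (- z) (- w) = stein_sol z w"
  by (simp add: stein_sol_def Phi_minus flip: minus_max_eq_min minus_min_eq_max)

lemma stein_sol_nonneg: "0 \<le> stein_sol z w"
  unfolding stein_sol_def using Phi_nonneg Phi_le_1
  by (auto intro!: divide_nonneg_nonneg mult_nonneg_nonneg)

text \<open>
  By symmetry \<open>z \<ge> 0\<close>. To the right of \<open>z\<close>, \<open>normal_tail_le\<close> bounds the left side by a constant while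
  the weight is at least \<open>1\<close>. For \<open>0 \<le> w \<le> z\<close> the tail at \<open>z\<close> leaves the quotient \<open>\<phi> z / \<phi> w\<close> of
  densities, to which \<open>gauss_le_growth\<close> applies. For \<open>w < 0\<close> the factor \<open>\<Phi> w\<close> is a tail that cancels
  \<open>\<phi> w\<close>, and the tail at \<open>z\<close> remains.
\<close>

lemma stein_sol_le:
  assumes "p \<ge> 0"
  shows "(1 + \<bar>w\<bar>) * stein_sol z w \<le> gauss_const p * growth p z w"
proof -
  have *: "(1 + \<bar>w\<bar>) * stein_sol z w \<le> gauss_const p * growth p z w" if "z \<ge> 0" for z w :: real
  proof -
    have tail: "(1 + \<bar>w\<bar>) * (1 - Phi \<bar>w\<bar>) / std_normal_density w \<le> 4 / 3" for w
      using normal_tail_le[of "\<bar>w\<bar>"] std_normal_density_gt_0[of w]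
      by (simp add: field_simps)
    have tail0: "0 \<le> (1 + \<bar>w\<bar>) * (1 - Phi \<bar>w\<bar>) / std_normal_density w" for w
      using Phi_le_1 by (intro divide_nonneg_nonneg mult_nonneg_nonneg) auto
    consider "z < w" | "0 \<le> w" "w \<le> z" | "w < 0" by linarith
    thus ?thesis
    proof cases
      case 1
      hence "(1 + \<bar>w\<bar>) * stein_sol z w = Phi z * ((1 + \<bar>w\<bar>) * (1 - Phi \<bar>w\<bar>) / std_normal_density w)"
        using that by (simp add: stein_sol_def)
      also have "\<dots> \<le> 1 * (4 / 3)"
        by (intro mult_mono tail tail0 Phi_le_1) auto
      also have "\<dots> \<le> gauss_const p * 1" 
        using gauss_const_ge[of p] by simp
      also have "\<dots> \<le> gauss_const p * growth p z w"
        using 1 that assms gauss_const_ge[of p] by (intro mult_left_mono growth_ge_1) auto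
      finally show ?thesis .
    next
      case 2
      have "(1 + \<bar>w\<bar>) * stein_sol z w = Phi w * ((1 + w) * (1 - Phi z) / std_normal_density w)"
        using 2 by (simp add: stein_sol_def)
      also have "\<dots> \<le> 1 * ((1 + z) * (1 - Phi z) / std_normal_density w)"
        using 2 Phi_le_1 Phi_nonneg by (intro mult_mono divide_right_mono mult_right_mono) auto
      also have "\<dots> \<le> 4 / 3 * std_normal_density z / std_normal_density w"
        using divide_right_mono[OF normal_tail_le[OF that], of "std_normal_density w"] by simp
      also have "\<dots> = 4 / 3 * exp (- (z\<^sup>2 - w\<^sup>2) / 2)"
        by (simp add: std_normal_density_def field_simps) (simp add: diff_divide_distrib flip: exp_add)
      also have "\<dots> \<le> 2 * (exp (p\<^sup>2 / 2) * growth p z w)"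
        using gauss_le_growth[OF assms 2] by (intro mult_mono) auto
      finally show ?thesis by (simp add: gauss_const_def)
    next
      case 3
      hence "(1 + \<bar>w\<bar>) * stein_sol z w = (1 - Phi z) * ((1 + \<bar>w\<bar>) * (1 - Phi \<bar>w\<bar>) / std_normal_density w)"
        using that Phi_minus[of w] by (simp add: stein_sol_def)
      also have "\<dots> \<le> (1 - Phi z) * (4 / 3)"
        using Phi_le_1 by (intro mult_left_mono tail) auto
      also have "\<dots> \<le> gauss_const p * growth p z w"
        using normal_tail_le_growth[OF assms that, of w] by simp
      finally show ?thesis .
    qed
  qed
  show ?thesis
  proof (cases "z \<ge> 0")
    case False
    thus ?thesis using *[of "- z" "- w"] by (simp add: stein_sol_minus)
  qed (rule *)
qed

section \<open>The Taylor remainder of the Stein solution\<close>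

text \<open>
  Off \<open>z\<close> this is the derivative of \<open>stein_sol z\<close>. At the kink \<open>w = z\<close> it is the left derivative,
  so that the Stein equation holds everywhere.
\<close>

definition stein_deriv :: "real \<Rightarrow> real \<Rightarrow> real" where
  "stein_deriv z w = w * stein_sol z w + stein_rhs z w"

lemma continuous_on_stein_sol: "continuous_on A (stein_sol z)"
proof -
  have "continuous_on UNIV Phi"
    using has_real_derivative_Phi DERIV_isCont continuous_at_imp_continuous_on by blast
  hence [continuous_intros]: "continuous_on A (\<lambda>x. Phi (g x))" if "continuous_on A g" for g :: "real \<Rightarrow> real"
    using continuous_on_compose2[OF _ that] by blast
  show ?thesis
    unfolding stein_sol_def[abs_def] using std_normal_density_gt_0
    by (intro continuous_intros) (auto simp: less_le)
qed

lemma has_real_derivative_stein_sol: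
  assumes "w \<noteq> z"
  shows "(stein_sol z has_real_derivative stein_deriv z w) (at w)"
proof -
  have [simp]: "std_normal_density w \<noteq> 0" 
    using std_normal_density_gt_0[of w] by simp
  show ?thesis
  proof (cases "w < z")
    case True
    have "((\<lambda>u. Phi u * (1 - Phi z) / std_normal_density u) has_real_derivative
        (std_normal_density w * (1 - Phi z) * std_normal_density w -
          Phi w * (1 - Phi z) * (- w * std_normal_density w)) /
        (std_normal_density w * std_normal_density w)) (at w)"
      by (intro DERIV_divide DERIV_cmult_right has_real_derivative_Phi
            has_real_derivative_std_normal_density) auto
    also have "(std_normal_density w * (1 - Phi z) * std_normal_density w -
          Phi w * (1 - Phi z) * (- w * std_normal_density w)) /
        (std_normal_density w * std_normal_density w) = stein_deriv z w"
      using True by (simp add: stein_deriv_def stein_sol_def stein_rhs_def field_simps)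
    finally show ?thesis
      by (rule has_field_derivative_transform_within_open[of _ _ _ "{..<z}"])
        (use True in \<open>auto simp: stein_sol_def\<close>)
  next
    case False
    have "((\<lambda>u. Phi z * (1 - Phi u) / std_normal_density u) has_real_derivative
        (Phi z * (0 - std_normal_density w) * std_normal_density w -
          Phi z * (1 - Phi w) * (- w * std_normal_density w)) /
        (std_normal_density w * std_normal_density w)) (at w)"
      by (intro DERIV_divide DERIV_cmult DERIV_diff DERIV_const has_real_derivative_Phi
            has_real_derivative_std_normal_density) auto
    also have "(Phi z * (0 - std_normal_density w) * std_normal_density w -
          Phi z * (1 - Phi w) * (- w * std_normal_density w)) /
        (std_normal_density w * std_normal_density w) = stein_deriv z w"
      using False assms by (simp add: stein_deriv_def stein_sol_def stein_rhs_def field_simps)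
    finally show ?thesis
      by (rule has_field_derivative_transform_within_open[of _ _ _ "{z<..}"])
        (use False assms in \<open>auto simp: stein_sol_def\<close>)
  qed
qed

lemma stein_sol_le_growth: "p \<ge> 0 \<Longrightarrow> stein_sol z w \<le> gauss_const p * growth p z w"
  by (rule order_trans[OF _ stein_sol_le[of p w z]])
    (simp_all add: algebra_simps stein_sol_nonneg)

lemma stein_deriv_le:
  assumes "p \<ge> 0"
  shows "\<bar>stein_deriv z w\<bar> \<le> 2 * gauss_const p * growth p z w"
proof -
  have "\<bar>stein_deriv z w\<bar> \<le> \<bar>w\<bar> * stein_sol z w + \<bar>stein_rhs z w\<bar>"
    unfolding stein_deriv_def using abs_triangle_ineq[of "w * stein_sol z w" "stein_rhs z w"]
    by (simp add: abs_mult stein_sol_nonneg)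
  also have "\<bar>w\<bar> * stein_sol z w \<le> (1 + \<bar>w\<bar>) * stein_sol z w"
    by (intro mult_right_mono stein_sol_nonneg) auto
  finally show ?thesis
    using stein_sol_le[OF assms, of w z] stein_rhs_le[OF assms, of z w] by simp
qed

lemma abs_diff_le_except_point:
  fixes f f' :: "real \<Rightarrow> real"
  assumes "continuous_on UNIV f"
    and "\<And>t. t \<noteq> z \<Longrightarrow> (f has_real_derivative f' t) (at t)"
    and "\<And>t. min x y \<le> t \<Longrightarrow> t \<le> max x y \<Longrightarrow> \<bar>f' t\<bar> \<le> M"
  shows "\<bar>f x - f y\<bar> \<le> M * \<bar>x - y\<bar>"
proof -
  have no_kink: "\<bar>f u - f v\<bar> \<le> M * (v - u)"
    if "min x y \<le> u" "u \<le> v" "v \<le> max x y" "z \<notin> {u<..<v}" for u v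
  proof (cases "u = v")
    case False
    have "f differentiable (at t)" if "u < t" "t < v" for t
      using that \<open>z \<notin> {u<..<v}\<close> assms(2)[of t] by (auto simp: real_differentiable_def)
    hence "\<exists>l t. u < t \<and> t < v \<and> DERIV f t :> l \<and> f v - f u = (v - u) * l"
      using that False by (intro MVT continuous_on_subset[OF assms(1)]) auto
    then obtain l t where t: "u < t" "t < v" "DERIV f t :> l" "f v - f u = (v - u) * l"
      by blast
    have "t \<noteq> z" using t that(4) by auto
    hence "l = f' t" using assms(2)[of t] t(3) DERIV_unique by blast
    hence "\<bar>l\<bar> \<le> M" using assms(3)[of t] that t by auto
    hence "\<bar>l\<bar> * (v - u) \<le> M * (v - u)" using that by (intro mult_right_mono) auto
    thus ?thesis
      using t(4) that(2) by (simp add: abs_minus_commute[of "f u"] abs_mult mult.commute)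
  qed auto
  have "\<bar>f u - f v\<bar> \<le> M * (v - u)" if "u = min x y" "v = max x y" for u v
  proof (cases "z \<in> {u<..<v}")
    case True
    have "\<bar>f u - f z\<bar> \<le> M * (z - u)" "\<bar>f z - f v\<bar> \<le> M * (v - z)"
      using True that by (auto intro!: no_kink)
    thus ?thesis by (simp add: algebra_simps)
  qed (use that no_kink[of u v] in auto)
  from this[OF refl refl] show ?thesis
    by (cases "x \<le> y") (auto simp: abs_minus_commute)
qed

lemma stein_sol_diff_le:
  assumes "p \<ge> 0" "\<bar>x\<bar> \<le> \<bar>m\<bar>" "\<bar>y\<bar> \<le> \<bar>m\<bar>"
  shows "\<bar>stein_sol z x - stein_sol z y\<bar> \<le> 2 * gauss_const p * growth p z m * \<bar>x - y\<bar>"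
proof (rule abs_diff_le_except_point)
  fix t assume "min x y \<le> t" "t \<le> max x y"
  hence "growth p z t \<le> growth p z m"
    using assms by (intro growth_mono) auto
  hence "2 * gauss_const p * growth p z t \<le> 2 * gauss_const p * growth p z m"
    using gauss_const_ge[of p] by (intro mult_left_mono) auto
  with stein_deriv_le[OF assms(1), of z t] show "\<bar>stein_deriv z t\<bar> \<le> 2 * gauss_const p * growth p z m"
    by linarith
qed (auto intro: continuous_on_stein_sol has_real_derivative_stein_sol)

lemma stein_remainder_le:
  assumes "p \<ge> 0"
  shows "\<bar>(x - y) * (stein_sol z x - stein_sol z y) - (x - y)\<^sup>2 * stein_deriv z x\<bar>
           \<le> 4 * gauss_const p * (x - y)\<^sup>2 * (growth p z x + growth p z y)"
proof -
  let ?G = "gauss_const p" and ?S = "growth p z x + growth p z y"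
  define m where "m = max \<bar>x\<bar> \<bar>y\<bar>"
  have "growth p z m \<le> ?S"
    using growth_nonneg[of p z x] growth_nonneg[of p z y] by (auto simp: m_def max_def growth_def)
  moreover have "\<bar>stein_sol z x - stein_sol z y\<bar> \<le> 2 * ?G * growth p z m * \<bar>x - y\<bar>"
    by (rule stein_sol_diff_le[OF assms]) (auto simp: m_def)
  moreover have "2 * ?G * growth p z m * \<bar>x - y\<bar> \<le> 2 * ?G * ?S * \<bar>x - y\<bar>"
    using gauss_const_ge[of p] calculation(1) by (intro mult_right_mono mult_left_mono) auto
  ultimately have "\<bar>x - y\<bar> * \<bar>stein_sol z x - stein_sol z y\<bar> \<le> \<bar>x - y\<bar> * (2 * ?G * ?S * \<bar>x - y\<bar>)"
    by (intro mult_left_mono) auto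
  also have "\<dots> = 2 * ?G * ?S * (x - y)\<^sup>2"
    using power2_abs[of "x - y"] by (simp add: power2_eq_square)
  finally have 1: "\<bar>(x - y) * (stein_sol z x - stein_sol z y)\<bar> \<le> 2 * ?G * ?S * (x - y)\<^sup>2"
    by (simp add: abs_mult)
  have "\<bar>stein_deriv z x\<bar> \<le> 2 * ?G * ?S"
    using stein_deriv_le[OF assms, of z x] gauss_const_ge[of p]
      mult_nonneg_nonneg[of ?G "growth p z y", OF _ growth_nonneg] by (simp add: algebra_simps)
  hence 2: "(x - y)\<^sup>2 * \<bar>stein_deriv z x\<bar> \<le> (x - y)\<^sup>2 * (2 * ?G * ?S)"
    by (rule mult_left_mono) simp
  have "\<bar>(x - y) * (stein_sol z x - stein_sol z y) - (x - y)\<^sup>2 * stein_deriv z x\<bar>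
      \<le> \<bar>(x - y) * (stein_sol z x - stein_sol z y)\<bar> + (x - y)\<^sup>2 * \<bar>stein_deriv z x\<bar>"
    using abs_triangle_ineq4 by (metis abs_mult abs_power2)
  also have "\<dots> \<le> 2 * ?G * ?S * (x - y)\<^sup>2 + (x - y)\<^sup>2 * (2 * ?G * ?S)"
    using 1 2 by (rule add_mono)
  also have "\<dots> = 4 * ?G * (x - y)\<^sup>2 * ?S" by algebra
  finally show ?thesis .
qed

text \<open>
  The solution is the sum of the primitive \<open>min w z - \<Phi> z * w\<close> of the right-hand side of the Stein
  equation and of a continuously differentiable function, whose derivative \<open>w * stein_sol z w\<close> is
  locally Lipschitz. The former has a kink at \<open>z\<close>, which is felt only if \<open>z\<close> lies between \<open>x\<close> and \<open>y\<close>.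
\<close>

lemma stein_remainder_le_small:
  assumes "p \<ge> 0" "\<bar>x - y\<bar> \<le> a" "a \<le> 1"
  shows "\<bar>(x - y) * (stein_sol z x - stein_sol z y) - (x - y)\<^sup>2 * stein_deriv z x\<bar>
           \<le> 2 * 2 powr p * gauss_const p * a ^ 3 * ((1 + \<bar>x\<bar>) * growth p z x)
             + (x - y)\<^sup>2 * indicator {z - a..z + a} x"
proof -
  let ?f = "stein_sol z" and ?G = "gauss_const p"
  \<comment> \<open>Any point between \<open>x\<close> and \<open>y\<close> is at most \<open>m\<close> in absolute value, and passing from \<open>x\<close> to
    \<open>m\<close> costs only a factor \<open>2 powr p\<close> of the weight.\<close>
  define m where "m = 1 + \<bar>x\<bar>"
  define L where "L = 2 * ?G * ((1 + \<bar>x\<bar>) * growth p z m)"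
  \<comment> \<open>\<open>H\<close> is the smooth part of the solution minus its linear part at \<open>x\<close>, so its increments
    measure the first-order remainder.\<close>
  define H where "H = (\<lambda>w. ?f w - (min w z - Phi z * w) - w * (x * ?f x))"
  have lip: "\<bar>t * ?f t - x * ?f x\<bar> \<le> L * \<bar>x - y\<bar>" if t: "min x y \<le> t" "t \<le> max x y" for t
  proof -
    have t_m: "\<bar>t\<bar> \<le> \<bar>m\<bar>" and t_x: "\<bar>t - x\<bar> \<le> \<bar>x - y\<bar>"
      using t assms by (auto simp: m_def)
    have "?f t \<le> ?G * growth p z t" by (rule stein_sol_le_growth[OF assms(1)])
    also have "\<dots> \<le> ?G * growth p z m"
      using gauss_const_ge[of p] by (intro mult_left_mono growth_mono assms t_m) auto
    finally have f_t: "?f t \<le> ?G * growth p z m" .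
    have "t * ?f t - x * ?f x = (t - x) * ?f t + x * (?f t - ?f x)"
      by (simp add: algebra_simps)
    hence "\<bar>t * ?f t - x * ?f x\<bar> \<le> \<bar>t - x\<bar> * ?f t + \<bar>x\<bar> * \<bar>?f t - ?f x\<bar>"
      using abs_triangle_ineq[of "(t - x) * ?f t" "x * (?f t - ?f x)"]
      by (simp add: abs_mult stein_sol_nonneg)
    also have "\<dots> \<le> \<bar>t - x\<bar> * (?G * growth p z m) + \<bar>x\<bar> * (2 * ?G * growth p z m * \<bar>t - x\<bar>)"
      using f_t t_m by (intro add_mono mult_left_mono stein_sol_diff_le assms) (auto simp: m_def)
    also have "\<dots> \<le> L * \<bar>t - x\<bar>"
      using gauss_const_ge[of p] growth_nonneg[of p z m]
      by (simp add: L_def algebra_simps)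
    also have "\<dots> \<le> L * \<bar>x - y\<bar>"
      using t_x gauss_const_ge[of p] growth_nonneg[of p z m] by (intro mult_left_mono) (auto simp: L_def)
    finally show ?thesis .
  qed
  have "\<bar>H x - H y\<bar> \<le> L * \<bar>x - y\<bar> * \<bar>x - y\<bar>"
  proof (rule abs_diff_le_except_point)
    show "continuous_on UNIV H"
      unfolding H_def by (intro continuous_intros continuous_on_stein_sol)
    show "(H has_real_derivative t * ?f t - x * ?f x) (at t)" if "t \<noteq> z" for t
    proof -
      have "((\<lambda>w. min w z) has_real_derivative indicator {..z} t) (at t)"
      proof (cases "t < z")
        case True
        have "((\<lambda>w. w) has_real_derivative 1) (at t)" by (rule DERIV_ident)
        hence "((\<lambda>w. min w z) has_real_derivative 1) (at t)"
          by (rule has_field_derivative_transform_within_open[of _ _ _ "{..<z}"]) (use True in auto)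
        thus ?thesis using True by simp
      next
        case False
        have "((\<lambda>w. z) has_real_derivative 0) (at t)" by (rule DERIV_const)
        hence "((\<lambda>w. min w z) has_real_derivative 0) (at t)"
          by (rule has_field_derivative_transform_within_open[of _ _ _ "{z<..}"]) (use False that in auto)
        thus ?thesis using False that by simp
      qed
      hence "(H has_real_derivative stein_deriv z t - (indicator {..z} t - Phi z * 1) - 1 * (x * ?f x)) (at t)"
        unfolding H_def
        by (intro DERIV_diff DERIV_cmult DERIV_cmult_right DERIV_ident has_real_derivative_stein_sol that)
      thus ?thesis by (simp add: stein_deriv_def stein_rhs_def)
    qed
  qed (use lip in auto)
  moreover have "\<bar>min x z - min y z - (x - y) * indicator {..z} x\<bar> \<le> \<bar>x - y\<bar> * indicator {z - a..z + a} x"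
    using assms(2) by (cases "x \<le> z"; cases "y \<le> z") (auto simp: indicator_def)
  moreover have "?f x - ?f y - (x - y) * stein_deriv z x =
      (H x - H y) + (min x z - min y z - (x - y) * indicator {..z} x)"
    by (simp add: H_def stein_deriv_def stein_rhs_def algebra_simps)
  ultimately have "\<bar>?f x - ?f y - (x - y) * stein_deriv z x\<bar> \<le>
      L * \<bar>x - y\<bar> * \<bar>x - y\<bar> + \<bar>x - y\<bar> * indicator {z - a..z + a} x"
    by linarith
  hence "\<bar>x - y\<bar> * \<bar>?f x - ?f y - (x - y) * stein_deriv z x\<bar> \<le>
      \<bar>x - y\<bar> * (L * \<bar>x - y\<bar> * \<bar>x - y\<bar> + \<bar>x - y\<bar> * indicator {z - a..z + a} x)"
    by (rule mult_left_mono) auto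
  also have "\<dots> = L * \<bar>x - y\<bar> ^ 3 + (x - y)\<^sup>2 * indicator {z - a..z + a} x"
  proof -
    have "d * (L * d * d + d * i) = L * d ^ 3 + d\<^sup>2 * i" for d i :: real
      by (simp add: power2_eq_square power3_eq_cube algebra_simps)
    from this[of "\<bar>x - y\<bar>"] show ?thesis by simp
  qed
  also have "\<bar>x - y\<bar> * \<bar>?f x - ?f y - (x - y) * stein_deriv z x\<bar> =
      \<bar>(x - y) * (?f x - ?f y) - (x - y)\<^sup>2 * stein_deriv z x\<bar>"
    by (simp add: power2_eq_square algebra_simps flip: abs_mult)
  also have "L * \<bar>x - y\<bar> ^ 3 \<le> (2 * ?G * ((1 + \<bar>x\<bar>) * (2 powr p * growth p z x))) * a ^ 3"
  proof (intro mult_mono power_mono assms)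
    have "growth p z m \<le> (2 * ((1 + \<bar>x\<bar>) / (1 + \<bar>z\<bar>))) powr p"
      unfolding growth_def m_def using assms by (intro powr_mono2) (auto simp: divide_simps)
    also have "\<dots> = 2 powr p * growth p z x"
      by (simp only: growth_def powr_mult)
    finally show "L \<le> 2 * ?G * ((1 + \<bar>x\<bar>) * (2 powr p * growth p z x))"
      unfolding L_def using gauss_const_ge[of p] by (intro mult_left_mono) auto
  qed (use gauss_const_ge[of p] growth_nonneg[of p z x] in auto)
  finally show ?thesis by (simp add: mult_ac)
qed

text \<open>
  The slope extends to distance \<open>2 * a\<close> from \<open>z\<close> in order to contain every pair of points at distance
  at most \<open>a\<close> one of which is at distance at most \<open>a\<close> from \<open>z\<close>. The additive constant makes the ramp
  vanish on the flat part that faces the origin, where the weight may be small.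
\<close>

definition ramp :: "real \<Rightarrow> real \<Rightarrow> real \<Rightarrow> real" where
  "ramp a z w = max (- 2 * a) (min (2 * a) (w - z)) + (if z \<ge> 0 then 2 * a else - 2 * a)"

lemma abs_ramp_le_growth:
  assumes "p \<ge> 0" "0 < a" "a \<le> 1"
  shows "\<bar>ramp a z w\<bar> \<le> 4 * 3 powr p * a * growth p z w"
proof (cases "ramp a z w = 0")
  case False
  hence "1 + \<bar>z\<bar> \<le> 3 * (1 + \<bar>w\<bar>)"
    using assms by (auto simp: ramp_def split: if_splits)
  hence "1 \<le> (3 * ((1 + \<bar>w\<bar>) / (1 + \<bar>z\<bar>))) powr p"
    using assms by (intro ge_one_powr_ge_zero) (auto simp: field_simps)
  also have "\<dots> = 3 powr p * growth p z w"
    by (simp only: growth_def powr_mult)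
  finally have "4 * a * 1 \<le> 4 * a * (3 powr p * growth p z w)"
    using assms by (intro mult_left_mono) auto
  moreover have "\<bar>ramp a z w\<bar> \<le> 4 * a"
    using assms by (auto simp: ramp_def)
  ultimately show ?thesis by (simp add: mult_ac)
qed (use assms growth_nonneg in auto)

lemma ramp_increment_ge:
  assumes "0 < a"
  shows "(x - y)\<^sup>2 * indicator {z - a..z + a} x * indicator {..a} \<bar>x - y\<bar>
    \<le> (x - y) * (ramp a z x - ramp a z y)"
proof (cases "x \<in> {z - a..z + a} \<and> \<bar>x - y\<bar> \<le> a")
  case True
  hence "ramp a z x - ramp a z y = x - y"
    unfolding ramp_def by (auto simp: abs_le_iff)
  thus ?thesis using True by (simp add: power2_eq_square)
next
  case False
  have "ramp a z x \<le> ramp a z y" if "x \<le> y" for x y using that unfolding ramp_def by auto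
  hence "0 \<le> (x - y) * (ramp a z x - ramp a z y)"
    using linear[of x y] by (auto intro: mult_nonneg_nonneg mult_nonpos_nonpos)
  thus ?thesis using False by auto
qed

section \<open>Exchangeable pairs with a linear regression property\<close>

lemma integrable_mult_of_squares:
  fixes f g :: "'a \<Rightarrow> real"
  assumes [measurable]: "f \<in> borel_measurable M" "g \<in> borel_measurable M"
    and "integrable M (\<lambda>x. (f x)\<^sup>2)" "integrable M (\<lambda>x. (g x)\<^sup>2)"
  shows "integrable M (\<lambda>x. f x * g x)"
proof (rule Bochner_Integration.integrable_bound)
  show "integrable M (\<lambda>x. (f x)\<^sup>2 + (g x)\<^sup>2)"
    using assms by simp
  show "AE x in M. norm (f x * g x) \<le> norm ((f x)\<^sup>2 + (g x)\<^sup>2)"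
  proof (rule AE_I2)
    fix x
    have "2 * (\<bar>f x\<bar> * \<bar>g x\<bar>) \<le> (f x)\<^sup>2 + (g x)\<^sup>2"
      using zero_le_power2[of "\<bar>f x\<bar> - \<bar>g x\<bar>"] by (simp add: power2_diff)
    moreover have "0 \<le> \<bar>f x\<bar> * \<bar>g x\<bar>" by simp
    ultimately have "\<bar>f x\<bar> * \<bar>g x\<bar> \<le> (f x)\<^sup>2 + (g x)\<^sup>2" by linarith
    thus "norm (f x * g x) \<le> norm ((f x)\<^sup>2 + (g x)\<^sup>2)"
      by (simp add: abs_mult)
  qed
qed measurable

lemma Cauchy_Schwarz_integral:
  fixes f g :: "'a \<Rightarrow> real"
  assumes [measurable]: "f \<in> borel_measurable M" "g \<in> borel_measurable M"
    and f: "integrable M (\<lambda>x. (f x)\<^sup>2)" and g: "integrable M (\<lambda>x. (g x)\<^sup>2)"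
  shows "(\<integral>x. \<bar>f x * g x\<bar> \<partial>M) \<le> sqrt (\<integral>x. (f x)\<^sup>2 \<partial>M) * sqrt (\<integral>x. (g x)\<^sup>2 \<partial>M)"
proof -
  have "ennreal (\<integral>x. \<bar>f x * g x\<bar> \<partial>M) = (\<integral>\<^sup>+x. ennreal \<bar>f x * g x\<bar> \<partial>M)"
    using integrable_mult_of_squares[OF assms] by (intro nn_integral_eq_integral[symmetric]) auto
  also have "\<dots> = (\<integral>\<^sup>+x. ennreal \<bar>f x\<bar> * ennreal \<bar>g x\<bar> \<partial>M)"
    by (simp add: abs_mult ennreal_mult')
  finally have "ennreal ((\<integral>x. \<bar>f x * g x\<bar> \<partial>M)\<^sup>2) = (\<integral>\<^sup>+x. ennreal \<bar>f x\<bar> * ennreal \<bar>g x\<bar> \<partial>M)\<^sup>2"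
    by (simp flip: ennreal_power)
  also have "\<dots> \<le> (\<integral>\<^sup>+x. ennreal \<bar>f x\<bar> ^ 2 \<partial>M) * (\<integral>\<^sup>+x. ennreal \<bar>g x\<bar> ^ 2 \<partial>M)"
    by (intro Cauchy_Schwarz_nn_integral) measurable
  also have "\<dots> = ennreal ((\<integral>x. (f x)\<^sup>2 \<partial>M) * (\<integral>x. (g x)\<^sup>2 \<partial>M))"
    using f g by (simp add: ennreal_power nn_integral_eq_integral ennreal_mult')
  finally have "(\<integral>x. \<bar>f x * g x\<bar> \<partial>M)\<^sup>2 \<le> (\<integral>x. (f x)\<^sup>2 \<partial>M) * (\<integral>x. (g x)\<^sup>2 \<partial>M)"
    by (subst (asm) ennreal_le_iff) (auto intro!: mult_nonneg_nonneg)
  hence "sqrt ((\<integral>x. \<bar>f x * g x\<bar> \<partial>M)\<^sup>2) \<le> sqrt ((\<integral>x. (f x)\<^sup>2 \<partial>M) * (\<integral>x. (g x)\<^sup>2 \<partial>M))"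
    by (rule real_sqrt_le_mono)
  thus ?thesis
    by (simp add: real_sqrt_mult)
qed

lemma borel_measurable_stein [measurable]:
  "growth p z \<in> borel_measurable borel"
  "stein_rhs z \<in> borel_measurable borel"
  "stein_sol z \<in> borel_measurable borel"
  "stein_deriv z \<in> borel_measurable borel"
  "ramp a z \<in> borel_measurable borel"
proof -
  show "stein_sol z \<in> borel_measurable borel"
    by (intro borel_measurable_continuous_onI continuous_on_stein_sol)
  thus "growth p z \<in> borel_measurable borel"
    "stein_rhs z \<in> borel_measurable borel"
    "stein_deriv z \<in> borel_measurable borel"
    "ramp a z \<in> borel_measurable borel"
    unfolding growth_def[abs_def] stein_rhs_def[abs_def] stein_deriv_def[abs_def] ramp_def[abs_def]
    by measurable
qed

lemma growth_eq: "growth p z w = (1 + \<bar>z\<bar>) powr - p * (1 + \<bar>w\<bar>) powr p"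
  by (simp add: growth_def powr_divide powr_minus_divide)

lemma powr_double: "x powr (2 * p) = (x powr p)\<^sup>2" for x p :: real
  by (simp only: mult_2 powr_add power2_eq_square)

lemma growth_sq: "(growth p z w)\<^sup>2 = ((1 + \<bar>z\<bar>) powr - p)\<^sup>2 * (1 + \<bar>w\<bar>) powr (2 * p)"
  by (simp only: growth_eq powr_double power_mult_distrib)

lemma mult_growth_le:
  assumes "p \<ge> 1"
  shows "(1 + \<bar>w\<bar>) * growth p z w \<le> (1 + \<bar>z\<bar>) powr - p * (1 + \<bar>w\<bar>) powr (2 * p)"
proof -
  have "(1 + \<bar>w\<bar>) * growth p z w \<le> (1 + \<bar>w\<bar>) powr p * growth p z w"
    using powr_mono[of 1 p "1 + \<bar>w\<bar>"] assms by (intro mult_right_mono growth_nonneg) auto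
  also have "\<dots> = (1 + \<bar>z\<bar>) powr - p * (1 + \<bar>w\<bar>) powr (2 * p)"
    unfolding growth_eq powr_double power2_eq_square by (rule mult.left_commute)
  finally show ?thesis .
qed

text \<open>
  The moment is taken of \<open>1 + \<bar>W\<bar>\<close> rather than of \<open>\<bar>W\<bar>\<close> since this is the numerator of the weight.
\<close>

locale linear_exchangeable_pair = prob_space M
  for M :: "'a measure" +
  fixes W W' R :: "'a \<Rightarrow> real" and r :: "real \<Rightarrow> real" and \<tau> p :: real
  assumes exchangeable: "exchangeable_pair M W W'"
    and \<tau>_pos: "0 < \<tau>"
    and p_ge_1: "1 \<le> p"
    and r_measurable [measurable]: "r \<in> borel_measurable borel"
    and R_eq: "R = (\<lambda>\<omega>. r (W \<omega>))"
    and regression: "AE \<omega> in M. cond_exp_given M W W' \<omega> = (1 - \<tau>) * W \<omega> + R \<omega>"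
    and integrable_moment: "integrable M (\<lambda>\<omega>. (1 + \<bar>W \<omega>\<bar>) powr (2 * p))"
    and integrable_R_sq: "integrable M (\<lambda>\<omega>. (R \<omega>)\<^sup>2)"
begin

definition moment :: real where
  "moment = (\<integral>\<omega>. (1 + \<bar>W \<omega>\<bar>) powr (2 * p) \<partial>M)"

abbreviation decay :: "real \<Rightarrow> real" where
  "decay z \<equiv> (1 + \<bar>z\<bar>) powr - p"

lemma W_measurable [measurable]: "W \<in> borel_measurable M" "W' \<in> borel_measurable M"
  using exchangeable by (auto simp: exchangeable_pair_def)

lemma R_measurable [measurable]: "R \<in> borel_measurable M"
  unfolding R_eq by measurable

sublocale W: finite_measure_subalgebra M "vimage_algebra (space M) W borel"
  by unfold_locales (simp add: subalgebra_def sets_image_in_sets)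

lemma measurable_comp_W:
  assumes [measurable]: "h \<in> borel_measurable borel"
  shows "(\<lambda>\<omega>. h (W \<omega>)) \<in> borel_measurable (vimage_algebra (space M) W borel)"
  by (rule measurable_compose[OF measurable_vimage_algebra1]) auto

lemma swap:
  fixes h :: "real \<times> real \<Rightarrow> real"
  assumes [measurable]: "h \<in> borel_measurable (borel \<Otimes>\<^sub>M borel)"
  shows "integrable M (\<lambda>\<omega>. h (W' \<omega>, W \<omega>)) = integrable M (\<lambda>\<omega>. h (W \<omega>, W' \<omega>))"
    and "(\<integral>\<omega>. h (W' \<omega>, W \<omega>) \<partial>M) = (\<integral>\<omega>. h (W \<omega>, W' \<omega>) \<partial>M)"
proof -
  have *: "distr M (borel \<Otimes>\<^sub>M borel) (\<lambda>\<omega>. (W \<omega>, W' \<omega>)) = distr M (borel \<Otimes>\<^sub>M borel) (\<lambda>\<omega>. (W' \<omega>, W \<omega>))"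
    using exchangeable by (simp add: exchangeable_pair_def)
  show "integrable M (\<lambda>\<omega>. h (W' \<omega>, W \<omega>)) = integrable M (\<lambda>\<omega>. h (W \<omega>, W' \<omega>))"
    using arg_cong[OF *, of "\<lambda>N. integrable N h"] by (simp add: integrable_distr_eq)
  show "(\<integral>\<omega>. h (W' \<omega>, W \<omega>) \<partial>M) = (\<integral>\<omega>. h (W \<omega>, W' \<omega>) \<partial>M)"
    using arg_cong[OF *, of "\<lambda>N. integral\<^sup>L N h"] by (simp add: integral_distr)
qed

lemma moment_ge_1: "1 \<le> moment"
proof -
  have "(\<integral>\<omega>. 1 \<partial>M) \<le> moment"
    unfolding moment_def using p_ge_1
    by (intro integral_mono integrable_moment ge_one_powr_ge_zero) auto
  thus ?thesis by (simp add: prob_space)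
qed

lemma square_integrable_growth:
  assumes [measurable]: "h \<in> borel_measurable borel" and h: "\<And>w. \<bar>h w\<bar> \<le> c * growth p z w"
  shows "integrable M (\<lambda>\<omega>. (h (W \<omega>))\<^sup>2)" "integrable M (\<lambda>\<omega>. (h (W' \<omega>))\<^sup>2)"
    and "sqrt (\<integral>\<omega>. (h (W \<omega>))\<^sup>2 \<partial>M) \<le> c * decay z * moment"
proof -
  have c: "0 \<le> c"
  proof -
    have "0 \<le> c * growth p z 0" using abs_ge_zero h[of 0] by (rule order_trans)
    moreover have "0 < growth p z 0" by (simp add: growth_def add_pos_nonneg)
    ultimately show ?thesis by (simp add: zero_le_mult_iff)
  qed
  have le: "(h w)\<^sup>2 \<le> (c * decay z)\<^sup>2 * (1 + \<bar>w\<bar>) powr (2 * p)" for w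
    using power_mono[OF h[of w], of 2] by (simp add: power_mult_distrib growth_sq mult_ac)
  have int: "integrable M (\<lambda>\<omega>. (c * decay z)\<^sup>2 * (1 + \<bar>W \<omega>\<bar>) powr (2 * p))"
    by (intro integrable_mult_right integrable_moment)
  thus int_h: "integrable M (\<lambda>\<omega>. (h (W \<omega>))\<^sup>2)"
    by (rule Bochner_Integration.integrable_bound) (use le in auto)
  thus "integrable M (\<lambda>\<omega>. (h (W' \<omega>))\<^sup>2)"
    using swap(1)[of "\<lambda>x. (h (fst x))\<^sup>2"] by simp
  have "(\<integral>\<omega>. (h (W \<omega>))\<^sup>2 \<partial>M) \<le> (\<integral>\<omega>. (c * decay z)\<^sup>2 * (1 + \<bar>W \<omega>\<bar>) powr (2 * p) \<partial>M)"
    by (intro integral_mono int int_h le)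
  also have "\<dots> = (c * decay z)\<^sup>2 * moment"
    by (simp add: moment_def)
  also have "\<dots> \<le> (c * decay z)\<^sup>2 * moment\<^sup>2"
    using moment_ge_1 self_le_power[of moment 2] by (intro mult_left_mono) auto
  finally have "sqrt (\<integral>\<omega>. (h (W \<omega>))\<^sup>2 \<partial>M) \<le> sqrt ((c * decay z * moment)\<^sup>2)"
    by (intro real_sqrt_le_mono) (simp add: power_mult_distrib)
  thus "sqrt (\<integral>\<omega>. (h (W \<omega>))\<^sup>2 \<partial>M) \<le> c * decay z * moment"
    using c moment_ge_1 by simp
qed

lemma Cauchy_Schwarz_growth:
  assumes [measurable]: "X \<in> borel_measurable M" "h \<in> borel_measurable borel"
    and X: "integrable M (\<lambda>\<omega>. (X \<omega>)\<^sup>2)" and h: "\<And>w. \<bar>h w\<bar> \<le> c * growth p z w"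
  shows "integrable M (\<lambda>\<omega>. X \<omega> * h (W \<omega>))"
    and "(\<integral>\<omega>. \<bar>X \<omega> * h (W \<omega>)\<bar> \<partial>M) \<le> sqrt (\<integral>\<omega>. (X \<omega>)\<^sup>2 \<partial>M) * (c * decay z * moment)"
proof -
  note h' = square_integrable_growth[OF assms(2) h]
  show "integrable M (\<lambda>\<omega>. X \<omega> * h (W \<omega>))"
    by (intro integrable_mult_of_squares X h') measurable
  have "(\<integral>\<omega>. \<bar>X \<omega> * h (W \<omega>)\<bar> \<partial>M) \<le> sqrt (\<integral>\<omega>. (X \<omega>)\<^sup>2 \<partial>M) * sqrt (\<integral>\<omega>. (h (W \<omega>))\<^sup>2 \<partial>M)"
    by (intro Cauchy_Schwarz_integral X h') measurable
  also have "\<dots> \<le> sqrt (\<integral>\<omega>. (X \<omega>)\<^sup>2 \<partial>M) * (c * decay z * moment)"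
    by (intro mult_left_mono h') auto
  finally show "(\<integral>\<omega>. \<bar>X \<omega> * h (W \<omega>)\<bar> \<partial>M) \<le> sqrt (\<integral>\<omega>. (X \<omega>)\<^sup>2 \<partial>M) * (c * decay z * moment)" .
qed

lemma integral_mult_growth_le:
  "integrable M (\<lambda>\<omega>. (1 + \<bar>W \<omega>\<bar>) * growth p z (W \<omega>))"
  "(\<integral>\<omega>. (1 + \<bar>W \<omega>\<bar>) * growth p z (W \<omega>) \<partial>M) \<le> decay z * moment"
proof -
  have int: "integrable M (\<lambda>\<omega>. decay z * (1 + \<bar>W \<omega>\<bar>) powr (2 * p))"
    by (intro integrable_mult_right integrable_moment)
  thus int': "integrable M (\<lambda>\<omega>. (1 + \<bar>W \<omega>\<bar>) * growth p z (W \<omega>))"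
    by (rule Bochner_Integration.integrable_bound)
      (use mult_growth_le[OF p_ge_1] in \<open>auto simp: growth_nonneg\<close>)
  have "(\<integral>\<omega>. (1 + \<bar>W \<omega>\<bar>) * growth p z (W \<omega>) \<partial>M) \<le> (\<integral>\<omega>. decay z * (1 + \<bar>W \<omega>\<bar>) powr (2 * p) \<partial>M)"
    by (intro integral_mono int int' mult_growth_le p_ge_1)
  thus "(\<integral>\<omega>. (1 + \<bar>W \<omega>\<bar>) * growth p z (W \<omega>) \<partial>M) \<le> decay z * moment"
    by (simp add: moment_def)
qed

lemma W_square_integrable:
  "integrable M (\<lambda>\<omega>. (W \<omega>)\<^sup>2)" "integrable M (\<lambda>\<omega>. (W' \<omega>)\<^sup>2)"
proof -
  have "\<bar>w\<bar> \<le> 1 * growth p 0 w" for w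
    using powr_mono[of 1 p "1 + \<bar>w\<bar>"] p_ge_1 by (simp add: growth_def)
  from square_integrable_growth(1,2)[OF _ this] show
    "integrable M (\<lambda>\<omega>. (W \<omega>)\<^sup>2)" "integrable M (\<lambda>\<omega>. (W' \<omega>)\<^sup>2)"
    by simp_all
qed

text \<open>
  Exchangeability turns the left side into \<open>2 E h W (W - W')\<close>; conditioning on \<open>W\<close> replaces \<open>W'\<close> by
  \<open>(1 - \<tau>) * W + R\<close>. The bound on \<open>h\<close> makes \<open>h W\<close> and \<open>h W'\<close> square-integrable, hence
  all products that occur integrable.
\<close>

lemma stein_identity:
  assumes [measurable]: "h \<in> borel_measurable borel" and h: "\<And>w. \<bar>h w\<bar> \<le> c * growth p z w"
  shows "integrable M (\<lambda>\<omega>. (W \<omega> - W' \<omega>) * (h (W \<omega>) - h (W' \<omega>)))"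
    and "(\<integral>\<omega>. (W \<omega> - W' \<omega>) * (h (W \<omega>) - h (W' \<omega>)) \<partial>M) =
      2 * (\<tau> * (\<integral>\<omega>. W \<omega> * h (W \<omega>) \<partial>M) - (\<integral>\<omega>. R \<omega> * h (W \<omega>) \<partial>M))"
proof -
  note h' = square_integrable_growth(1,2)[OF assms]
  have int: "integrable M (\<lambda>\<omega>. W \<omega> * h (W \<omega>))" "integrable M (\<lambda>\<omega>. W' \<omega> * h (W \<omega>))"
    "integrable M (\<lambda>\<omega>. W \<omega> * h (W' \<omega>))" "integrable M (\<lambda>\<omega>. W' \<omega> * h (W' \<omega>))"
    "integrable M (\<lambda>\<omega>. R \<omega> * h (W \<omega>))" "integrable M (\<lambda>\<omega>. h (W \<omega>) * W' \<omega>)"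
    by (intro integrable_mult_of_squares W_square_integrable h' integrable_R_sq; measurable)+
  have eq: "(W \<omega> - W' \<omega>) * (h (W \<omega>) - h (W' \<omega>)) =
      (W \<omega> * h (W \<omega>) - W' \<omega> * h (W \<omega>)) - (W \<omega> * h (W' \<omega>) - W' \<omega> * h (W' \<omega>))" for \<omega>
    by (simp add: algebra_simps)
  show "integrable M (\<lambda>\<omega>. (W \<omega> - W' \<omega>) * (h (W \<omega>) - h (W' \<omega>)))"
    unfolding eq using int by simp
  have "(\<integral>\<omega>. h (W \<omega>) * W' \<omega> \<partial>M) = (\<integral>\<omega>. h (W \<omega>) * cond_exp_given M W W' \<omega> \<partial>M)"
    unfolding cond_exp_given_def
    by (rule W.real_cond_exp_intg(2)[symmetric, OF int(6) measurable_comp_W]) measurable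
  also have "\<dots> = (\<integral>\<omega>. (1 - \<tau>) * (W \<omega> * h (W \<omega>)) + R \<omega> * h (W \<omega>) \<partial>M)"
  proof (rule integral_cong_AE)
    show "AE \<omega> in M. h (W \<omega>) * cond_exp_given M W W' \<omega> = (1 - \<tau>) * (W \<omega> * h (W \<omega>)) + R \<omega> * h (W \<omega>)"
      using regression by eventually_elim (simp only: ring_distribs mult_ac)
  qed (simp_all add: cond_exp_given_def)
  also have "\<dots> = (1 - \<tau>) * (\<integral>\<omega>. W \<omega> * h (W \<omega>) \<partial>M) + (\<integral>\<omega>. R \<omega> * h (W \<omega>) \<partial>M)"
    using int by simp
  finally have cond: "(\<integral>\<omega>. W' \<omega> * h (W \<omega>) \<partial>M) =
      (1 - \<tau>) * (\<integral>\<omega>. W \<omega> * h (W \<omega>) \<partial>M) + (\<integral>\<omega>. R \<omega> * h (W \<omega>) \<partial>M)"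
    by (simp add: mult.commute)
  have "(\<integral>\<omega>. W' \<omega> * h (W' \<omega>) \<partial>M) = (\<integral>\<omega>. W \<omega> * h (W \<omega>) \<partial>M)"
    using swap(2)[of "\<lambda>x. fst x * h (fst x)"] by simp
  moreover have "(\<integral>\<omega>. W \<omega> * h (W' \<omega>) \<partial>M) = (\<integral>\<omega>. W' \<omega> * h (W \<omega>) \<partial>M)"
    using swap(2)[of "\<lambda>x. snd x * h (fst x)"] by simp
  ultimately show "(\<integral>\<omega>. (W \<omega> - W' \<omega>) * (h (W \<omega>) - h (W' \<omega>)) \<partial>M) =
      2 * (\<tau> * (\<integral>\<omega>. W \<omega> * h (W \<omega>) \<partial>M) - (\<integral>\<omega>. R \<omega> * h (W \<omega>) \<partial>M))"
    unfolding eq using int by (simp add: cond) (simp add: algebra_simps)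
qed

text \<open>
  The variable \<open>Y\<close> is at most \<open>(W - W') * (h W - h W')\<close> for the ramp \<open>h\<close>, because \<open>h\<close> is increasing and
  has slope \<open>1\<close> near \<open>z\<close>. The Stein identity evaluates the expectation of this product, and there
  the small height of the ramp supplies the factor \<open>a\<close>.
\<close>

lemma concentration:
  fixes z :: real
  assumes a: "0 < a" "a \<le> 1"
  defines "Y \<equiv> \<lambda>\<omega>. (W \<omega> - W' \<omega>)\<^sup>2 * indicator {z - a..z + a} (W \<omega>) * indicator {..a} \<bar>W \<omega> - W' \<omega>\<bar>"
  shows "integrable M Y"
    and "(\<integral>\<omega>. Y \<omega> \<partial>M)
      \<le> 8 * 3 powr p * a * decay z * moment * (\<tau> + sqrt (\<integral>\<omega>. (R \<omega>)\<^sup>2 \<partial>M))"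
proof -
  let ?h = "ramp a z" and ?c = "4 * 3 powr p * a"
  have h: "\<bar>?h w\<bar> \<le> ?c * growth p z w" for w
    using p_ge_1 a by (intro abs_ramp_le_growth) auto
  note id = stein_identity[OF borel_measurable_stein(5) h]
  have Y_le: "Y \<omega> \<le> (W \<omega> - W' \<omega>) * (?h (W \<omega>) - ?h (W' \<omega>))" for \<omega>
    unfolding Y_def by (rule ramp_increment_ge[OF a(1)])
  have Y_nonneg: "0 \<le> Y \<omega>" for \<omega>
    unfolding Y_def by simp
  show int_Y: "integrable M Y"
  proof (rule Bochner_Integration.integrable_bound[OF id(1)])
    show "Y \<in> borel_measurable M" unfolding Y_def by measurable
    show "AE \<omega> in M. norm (Y \<omega>) \<le> norm ((W \<omega> - W' \<omega>) * (?h (W \<omega>) - ?h (W' \<omega>)))"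
      using order_trans[OF Y_le abs_ge_self] Y_nonneg by (intro AE_I2) simp
  qed
  have "\<bar>\<integral>\<omega>. W \<omega> * ?h (W \<omega>) \<partial>M\<bar> \<le> (\<integral>\<omega>. ?c * ((1 + \<bar>W \<omega>\<bar>) * growth p z (W \<omega>)) \<partial>M)"
  proof (rule integral_abs_bound[THEN order_trans], rule integral_mono)
    fix \<omega>
    have "\<bar>W \<omega>\<bar> * \<bar>?h (W \<omega>)\<bar> \<le> (1 + \<bar>W \<omega>\<bar>) * (?c * growth p z (W \<omega>))"
      by (intro mult_mono h) auto
    thus "\<bar>W \<omega> * ?h (W \<omega>)\<bar> \<le> ?c * ((1 + \<bar>W \<omega>\<bar>) * growth p z (W \<omega>))"
      by (simp add: abs_mult mult_ac)
  next
    show "integrable M (\<lambda>\<omega>. \<bar>W \<omega> * ?h (W \<omega>)\<bar>)"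
      by (intro integrable_abs Cauchy_Schwarz_growth(1)[OF _ _ W_square_integrable(1) h]) measurable
    show "integrable M (\<lambda>\<omega>. ?c * ((1 + \<bar>W \<omega>\<bar>) * growth p z (W \<omega>)))"
      by (intro integrable_mult_right integral_mult_growth_le)
  qed
  also have "\<dots> \<le> ?c * (decay z * moment)"
    using a integral_mult_growth_le(2)[of z] by (simp add: mult_left_mono)
  finally have "\<tau> * (\<integral>\<omega>. W \<omega> * ?h (W \<omega>) \<partial>M) \<le> \<tau> * (?c * (decay z * moment))"
    using \<tau>_pos by (intro mult_left_mono) auto
  moreover have "\<bar>\<integral>\<omega>. R \<omega> * ?h (W \<omega>) \<partial>M\<bar> \<le> sqrt (\<integral>\<omega>. (R \<omega>)\<^sup>2 \<partial>M) * (?c * decay z * moment)"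
    by (rule integral_abs_bound[THEN order_trans])
      (rule Cauchy_Schwarz_growth[OF R_measurable borel_measurable_stein(5) integrable_R_sq h])
  moreover have "(\<integral>\<omega>. Y \<omega> \<partial>M) \<le> (\<integral>\<omega>. (W \<omega> - W' \<omega>) * (?h (W \<omega>) - ?h (W' \<omega>)) \<partial>M)"
    by (intro integral_mono int_Y id(1) Y_le)
  moreover have "y \<le> 2 * (A + B)" if "t \<le> A" "\<bar>s\<bar> \<le> B" "y \<le> 2 * (t - s)" for y t s A B :: real
  proof -
    have "t - s \<le> A + B" using that by linarith
    thus ?thesis using that(3) by (simp add: order_trans)
  qed
  ultimately have "(\<integral>\<omega>. Y \<omega> \<partial>M) \<le> 2 * (\<tau> * (?c * (decay z * moment)) +
      sqrt (\<integral>\<omega>. (R \<omega>)\<^sup>2 \<partial>M) * (?c * decay z * moment))"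
    unfolding id(2) by blast
  also have "\<dots> = 8 * 3 powr p * a * decay z * moment * (\<tau> + sqrt (\<integral>\<omega>. (R \<omega>)\<^sup>2 \<partial>M))"
    by (simp only: ring_distribs mult_ac)
  finally show "(\<integral>\<omega>. Y \<omega> \<partial>M)
      \<le> 8 * 3 powr p * a * decay z * moment * (\<tau> + sqrt (\<integral>\<omega>. (R \<omega>)\<^sup>2 \<partial>M))" .
qed

lemma cdf_error_eq:
  "measure M {\<omega> \<in> space M. W \<omega> \<le> z} - Phi z = (\<integral>\<omega>. stein_rhs z (W \<omega>) \<partial>M)"
proof -
  have "(\<integral>\<omega>. stein_rhs z (W \<omega>) \<partial>M) = (\<integral>\<omega>. indicator {\<omega> \<in> space M. W \<omega> \<le> z} \<omega> - Phi z \<partial>M)"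
    unfolding stein_rhs_def by (intro Bochner_Integration.integral_cong) (auto simp: indicator_def)
  also have "\<dots> = measure M {\<omega> \<in> space M. W \<omega> \<le> z} - Phi z"
    by (subst Bochner_Integration.integral_diff) (auto simp: prob_space emeasure_eq_measure)
  finally show ?thesis ..
qed

lemma trivial_bound:
  "\<bar>measure M {\<omega> \<in> space M. W \<omega> \<le> z} - Phi z\<bar> \<le> gauss_const p * decay z * moment"
proof -
  have rhs: "\<bar>stein_rhs z w\<bar> \<le> gauss_const p * growth p z w" for w
    using p_ge_1 by (intro stein_rhs_le) auto
  have "\<bar>measure M {\<omega> \<in> space M. W \<omega> \<le> z} - Phi z\<bar> \<le> (\<integral>\<omega>. \<bar>1 * stein_rhs z (W \<omega>)\<bar> \<partial>M)"
    unfolding cdf_error_eq using integral_abs_bound[of M "\<lambda>\<omega>. stein_rhs z (W \<omega>)"] by simp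
  also have "\<dots> \<le> sqrt (\<integral>\<omega>. 1\<^sup>2 \<partial>M) * (gauss_const p * decay z * moment)"
    by (rule Cauchy_Schwarz_growth(2)) (auto intro: rhs)
  finally show ?thesis by (simp add: prob_space)
qed

end

section \<open>The error of the normal approximation\<close>

lemma one_plus_powr_le:
  fixes x p :: real
  assumes "0 \<le> p" "0 \<le> x"
  shows "(1 + x) powr (2 * p) \<le> 4 powr p * (1 + x powr (2 * p))"
proof -
  have "(1 + x) powr (2 * p) \<le> (2 * max 1 x) powr (2 * p)"
    using assms by (intro powr_mono2) auto
  also have "\<dots> = 2 powr (2 * p) * max 1 x powr (2 * p)"
    by (rule powr_mult)
  also have "2 powr (2 * p) = (4::real) powr p"
    by (simp flip: powr_powr)
  also have "4 powr p * max 1 x powr (2 * p) \<le> 4 powr p * (1 + x powr (2 * p))"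
    using assms by (intro mult_left_mono) (auto simp: max_def)
  finally show ?thesis .
qed

context linear_exchangeable_pair
begin

text \<open>
  This is the Stein identity for \<open>stein_sol z\<close> together with the remainder estimates. Below, \<open>q\<close> is the
  conditional second moment of \<open>\<Delta>\<close>, \<open>V\<close> its normalized deviation, \<open>E\<close> and \<open>Y\<close> are the parts of \<open>\<Delta>\<^sup>2\<close>
  coming from large increments and from small increments near \<open>z\<close>, and \<open>T\<close> is the remainder.
\<close>

lemma small_step_bound:
  assumes a: "0 < a" "a \<le> 1"
    and variance_term: "integrable M (\<lambda>\<omega>. (1 - 1 / (2 * \<tau>) * cond_exp_given M W (\<lambda>\<omega>. (W \<omega> - W' \<omega>)\<^sup>2) \<omega>)\<^sup>2)"
    and tail_term: "integrable M (\<lambda>\<omega>. (W \<omega> - W' \<omega>) ^ 4 * indicator {a<..} \<bar>W \<omega> - W' \<omega>\<bar>)"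
  shows "\<bar>measure M {\<omega> \<in> space M. W \<omega> \<le> z} - Phi z\<bar> \<le> 4 * 3 powr p * gauss_const p * decay z * moment *
    (sqrt (\<integral>\<omega>. (1 - 1 / (2 * \<tau>) * cond_exp_given M W (\<lambda>\<omega>. (W \<omega> - W' \<omega>)\<^sup>2) \<omega>)\<^sup>2 \<partial>M)
     + sqrt (\<integral>\<omega>. (R \<omega>)\<^sup>2 \<partial>M) / \<tau> + a + a ^ 3 / \<tau>
     + sqrt (\<integral>\<omega>. (W \<omega> - W' \<omega>) ^ 4 * indicator {a<..} \<bar>W \<omega> - W' \<omega>\<bar> \<partial>M) / \<tau>)"
proof -
  define \<Delta> where "\<Delta> = (\<lambda>\<omega>. W \<omega> - W' \<omega>)"
  define q where "q = cond_exp_given M W (\<lambda>\<omega>. (\<Delta> \<omega>)\<^sup>2)"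
  define V where "V = (\<lambda>\<omega>. 1 - 1 / (2 * \<tau>) * q \<omega>)"
  define E where "E = (\<lambda>\<omega>. (\<Delta> \<omega>)\<^sup>2 * indicator {a<..} \<bar>\<Delta> \<omega>\<bar>)"
  define Y where "Y = (\<lambda>\<omega>. (\<Delta> \<omega>)\<^sup>2 * indicator {z - a..z + a} (W \<omega>) * indicator {..a} \<bar>\<Delta> \<omega>\<bar>)"
  define T where "T = (\<lambda>\<omega>. \<Delta> \<omega> * (stein_sol z (W \<omega>) - stein_sol z (W' \<omega>)) - (\<Delta> \<omega>)\<^sup>2 * stein_deriv z (W \<omega>))"
  define G where "G = gauss_const p"
  define N where "N = decay z * moment"
  define S where "S = sqrt (\<integral>\<omega>. (V \<omega>)\<^sup>2 \<partial>M)"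
  define S' where "S' = sqrt (\<integral>\<omega>. (R \<omega>)\<^sup>2 \<partial>M)"
  define S'' where "S'' = sqrt (\<integral>\<omega>. (E \<omega>)\<^sup>2 \<partial>M)"
  have p: "0 \<le> p" using p_ge_1 by simp
  have G: "2 \<le> G" unfolding G_def by (rule gauss_const_ge)
  have N: "0 \<le> N" unfolding N_def using moment_ge_1 by simp
  have S_nonneg: "0 \<le> S" "0 \<le> S'" "0 \<le> S''" by (simp_all add: S_def S'_def S''_def)
  have [measurable]: "\<Delta> \<in> borel_measurable M" "q \<in> borel_measurable M" "V \<in> borel_measurable M"
      "E \<in> borel_measurable M" "Y \<in> borel_measurable M" "T \<in> borel_measurable M"
    unfolding V_def E_def Y_def T_def q_def \<Delta>_def cond_exp_given_def by measurable
  have sol: "\<bar>stein_sol z w\<bar> \<le> G * growth p z w" for w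
    using stein_sol_le_growth[OF p, of z w] stein_sol_nonneg[of z w] by (simp add: G_def)
  have deriv: "\<bar>stein_deriv z w\<bar> \<le> 2 * G * growth p z w" for w
    using stein_deriv_le[OF p] by (simp add: G_def)
  have gr: "\<bar>growth p z w\<bar> \<le> 1 * growth p z w" for w
    by (simp add: growth_nonneg)

  have E_sq: "(E \<omega>)\<^sup>2 = (\<Delta> \<omega>) ^ 4 * indicator {a<..} \<bar>\<Delta> \<omega>\<bar>" for \<omega>
    by (auto simp: E_def indicator_def)
  have V_int: "integrable M (\<lambda>\<omega>. (V \<omega>)\<^sup>2)"
    using variance_term by (simp add: V_def q_def \<Delta>_def)
  have E_int: "integrable M (\<lambda>\<omega>. (E \<omega>)\<^sup>2)"
    unfolding E_sq using tail_term by (simp add: \<Delta>_def)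
  \<comment> \<open>A finite tail term makes \<open>\<Delta>\<^sup>2\<close> square-integrable, which is needed to condition the product
    of \<open>\<Delta>\<^sup>2\<close> and \<open>stein_deriv z W\<close> on \<open>W\<close>.\<close>
  have \<Delta>_int: "integrable M (\<lambda>\<omega>. ((\<Delta> \<omega>)\<^sup>2)\<^sup>2)"
  proof (rule Bochner_Integration.integrable_bound)
    show "integrable M (\<lambda>\<omega>. a ^ 4 + (E \<omega>)\<^sup>2)" using E_int by simp
    have "((\<Delta> \<omega>)\<^sup>2)\<^sup>2 \<le> a ^ 4 + (E \<omega>)\<^sup>2" for \<omega>
    proof (cases "\<bar>\<Delta> \<omega>\<bar> \<le> a")
      case True
      hence "\<bar>\<Delta> \<omega>\<bar> ^ 4 \<le> a ^ 4" by (intro power_mono) auto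
      thus ?thesis by (simp add: add_increasing2)
    qed (use a in \<open>auto simp: E_def\<close>)
    thus "AE \<omega> in M. norm (((\<Delta> \<omega>)\<^sup>2)\<^sup>2) \<le> norm (a ^ 4 + (E \<omega>)\<^sup>2)"
      by (intro AE_I2) (simp add: a abs_of_nonneg)
  qed measurable

  note stein = stein_identity[OF borel_measurable_stein(3) sol, folded \<Delta>_def]
  note deriv_\<Delta> = Cauchy_Schwarz_growth[OF _ borel_measurable_stein(4) \<Delta>_int deriv]
  note deriv_V = Cauchy_Schwarz_growth[OF _ borel_measurable_stein(4) V_int deriv]
  note sol_R = Cauchy_Schwarz_growth[OF _ borel_measurable_stein(3) integrable_R_sq sol]
  note sol_W = Cauchy_Schwarz_growth(1)[OF _ borel_measurable_stein(3) W_square_integrable(1) sol]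
  have deriv_int: "integrable M (\<lambda>\<omega>. stein_deriv z (W \<omega>))"
    using Cauchy_Schwarz_growth(1)[OF _ borel_measurable_stein(4) _ deriv, of "\<lambda>_. 1"] by simp
  have deriv_\<Delta>': "integrable M (\<lambda>\<omega>. stein_deriv z (W \<omega>) * (\<Delta> \<omega>)\<^sup>2)"
    using deriv_\<Delta>(1) by (simp add: mult.commute)
  have cond: "integrable M (\<lambda>\<omega>. stein_deriv z (W \<omega>) * q \<omega>)"
    "(\<integral>\<omega>. stein_deriv z (W \<omega>) * q \<omega> \<partial>M) = (\<integral>\<omega>. (\<Delta> \<omega>)\<^sup>2 * stein_deriv z (W \<omega>) \<partial>M)"
    using W.real_cond_exp_intg[OF deriv_\<Delta>' measurable_comp_W]
    by (simp_all add: q_def cond_exp_given_def mult.commute)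

  have error: "(\<integral>\<omega>. stein_rhs z (W \<omega>) \<partial>M) =
      (\<integral>\<omega>. V \<omega> * stein_deriv z (W \<omega>) \<partial>M) - (\<integral>\<omega>. T \<omega> \<partial>M) / (2 * \<tau>)
      - (\<integral>\<omega>. R \<omega> * stein_sol z (W \<omega>) \<partial>M) / \<tau>"
  proof -
    have "(\<integral>\<omega>. stein_rhs z (W \<omega>) \<partial>M) =
        (\<integral>\<omega>. stein_deriv z (W \<omega>) - W \<omega> * stein_sol z (W \<omega>) \<partial>M)"
      by (simp add: stein_deriv_def)
    also have "\<dots> = (\<integral>\<omega>. stein_deriv z (W \<omega>) \<partial>M) - (\<integral>\<omega>. W \<omega> * stein_sol z (W \<omega>) \<partial>M)"
      using deriv_int sol_W by simp
    finally have 1: "(\<integral>\<omega>. stein_rhs z (W \<omega>) \<partial>M) =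
      (\<integral>\<omega>. stein_deriv z (W \<omega>) \<partial>M) - (\<integral>\<omega>. W \<omega> * stein_sol z (W \<omega>) \<partial>M)" .
    have "(\<integral>\<omega>. V \<omega> * stein_deriv z (W \<omega>) \<partial>M) =
        (\<integral>\<omega>. stein_deriv z (W \<omega>) - 1 / (2 * \<tau>) * (stein_deriv z (W \<omega>) * q \<omega>) \<partial>M)"
      by (simp add: V_def algebra_simps)
    also have "\<dots> = (\<integral>\<omega>. stein_deriv z (W \<omega>) \<partial>M) - 1 / (2 * \<tau>) * (\<integral>\<omega>. (\<Delta> \<omega>)\<^sup>2 * stein_deriv z (W \<omega>) \<partial>M)"
      unfolding cond(2)[symmetric] using deriv_int cond(1) by simp
    finally have 2: "(\<integral>\<omega>. V \<omega> * stein_deriv z (W \<omega>) \<partial>M) =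
      (\<integral>\<omega>. stein_deriv z (W \<omega>) \<partial>M) - 1 / (2 * \<tau>) * (\<integral>\<omega>. (\<Delta> \<omega>)\<^sup>2 * stein_deriv z (W \<omega>) \<partial>M)" .
    have "(\<integral>\<omega>. T \<omega> \<partial>M) = 
        (\<integral>\<omega>. \<Delta> \<omega> * (stein_sol z (W \<omega>) - stein_sol z (W' \<omega>)) \<partial>M) - (\<integral>\<omega>. (\<Delta> \<omega>)\<^sup>2 * stein_deriv z (W \<omega>) \<partial>M)"
      unfolding T_def using stein(1) deriv_\<Delta>(1) by (simp add: \<Delta>_def)
    also have "(\<integral>\<omega>. \<Delta> \<omega> * (stein_sol z (W \<omega>) - stein_sol z (W' \<omega>)) \<partial>M) =
        2 * (\<tau> * (\<integral>\<omega>. W \<omega> * stein_sol z (W \<omega>) \<partial>M) - (\<integral>\<omega>. R \<omega> * stein_sol z (W \<omega>) \<partial>M))"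
      using stein(2) by (simp add: \<Delta>_def)
    finally have "(\<integral>\<omega>. W \<omega> * stein_sol z (W \<omega>) \<partial>M) =
        1 / (2 * \<tau>) * (\<integral>\<omega>. (\<Delta> \<omega>)\<^sup>2 * stein_deriv z (W \<omega>) \<partial>M) + (\<integral>\<omega>. T \<omega> \<partial>M) / (2 * \<tau>)
        + (\<integral>\<omega>. R \<omega> * stein_sol z (W \<omega>) \<partial>M) / \<tau>"
      using \<tau>_pos by (simp add: field_simps)
    thus ?thesis unfolding 1 2 by simp
  qed

  have gr_E: "integrable M (\<lambda>\<omega>. E \<omega> * growth p z (W \<omega>))"
      "(\<integral>\<omega>. E \<omega> * growth p z (W \<omega>) \<partial>M) \<le> S'' * N"
      "integrable M (\<lambda>\<omega>. E \<omega> * growth p z (W' \<omega>))"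
      "(\<integral>\<omega>. E \<omega> * growth p z (W' \<omega>) \<partial>M) \<le> S'' * N"
  proof -
    note * = Cauchy_Schwarz_growth[OF _ borel_measurable_stein(1) E_int gr]
    show 1: "integrable M (\<lambda>\<omega>. E \<omega> * growth p z (W \<omega>))"
      using *(1) by simp
    show 2: "(\<integral>\<omega>. E \<omega> * growth p z (W \<omega>) \<partial>M) \<le> S'' * N"
      using *(2) by (simp add: E_def growth_nonneg S''_def N_def)
    \<comment> \<open>Exchanging \<open>W\<close> and \<open>W'\<close> leaves \<open>E\<close> unchanged, so the weight may be taken at \<open>W'\<close>.\<close>
    let ?h = "\<lambda>x. (fst x - snd x)\<^sup>2 * indicator {a<..} \<bar>fst x - snd x\<bar> * growth p z (fst x)"
    have [measurable]: "?h \<in> borel_measurable (borel \<Otimes>\<^sub>M borel)" by measurable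
    have eq: "?h (W \<omega>, W' \<omega>) = E \<omega> * growth p z (W \<omega>)" "?h (W' \<omega>, W \<omega>) = E \<omega> * growth p z (W' \<omega>)" for \<omega>
      by (simp_all add: E_def \<Delta>_def abs_minus_commute power2_commute)
    show "integrable M (\<lambda>\<omega>. E \<omega> * growth p z (W' \<omega>))"
      "(\<integral>\<omega>. E \<omega> * growth p z (W' \<omega>) \<partial>M) \<le> S'' * N"
      using swap[of ?h] 1 2 unfolding eq by simp_all
  qed

  have T_le: "\<bar>T \<omega>\<bar> \<le> 2 * 2 powr p * G * a ^ 3 * ((1 + \<bar>W \<omega>\<bar>) * growth p z (W \<omega>)) + Y \<omega>
      + 4 * G * (E \<omega> * growth p z (W \<omega>) + E \<omega> * growth p z (W' \<omega>))" for \<omega>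
  proof (cases "\<bar>\<Delta> \<omega>\<bar> \<le> a")
    case True
    have "Y \<omega> = (\<Delta> \<omega>)\<^sup>2 * indicator {z - a..z + a} (W \<omega>)" "E \<omega> = 0"
      using True by (simp_all add: Y_def E_def)
    thus ?thesis
      using stein_remainder_le_small[OF p True[unfolded \<Delta>_def] a(2), of z]
      by (simp add: T_def \<Delta>_def G_def)
  next
    case False
    have "Y \<omega> = 0" "E \<omega> = (\<Delta> \<omega>)\<^sup>2"
      using False by (simp_all add: Y_def E_def)
    moreover have "0 \<le> 2 * 2 powr p * G * a ^ 3 * ((1 + \<bar>W \<omega>\<bar>) * growth p z (W \<omega>))"
      using a G by (intro mult_nonneg_nonneg growth_nonneg) auto
    ultimately show ?thesis
      using stein_remainder_le[OF p, of "W \<omega>" "W' \<omega>" z]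
      by (simp add: T_def \<Delta>_def G_def algebra_simps)
  qed
  have T_bound: "(\<integral>\<omega>. \<bar>T \<omega>\<bar> \<partial>M) \<le> 2 * 2 powr p * G * a ^ 3 * N + 8 * 3 powr p * a * N * (\<tau> + S') + 8 * G * (S'' * N)"
  proof -
    note Y' = concentration[OF a, of z, folded \<Delta>_def]
    have Y: "integrable M Y" "(\<integral>\<omega>. Y \<omega> \<partial>M) \<le> 8 * 3 powr p * a * N * (\<tau> + S')"
      using Y' by (simp_all add: Y_def \<Delta>_def N_def S'_def mult.assoc)
    have T_int: "integrable M T"
      unfolding T_def using stein(1) deriv_\<Delta>(1) by (simp add: \<Delta>_def)
    have "(\<integral>\<omega>. \<bar>T \<omega>\<bar> \<partial>M) \<le> (\<integral>\<omega>. 2 * 2 powr p * G * a ^ 3 * ((1 + \<bar>W \<omega>\<bar>) * growth p z (W \<omega>)) + Y \<omega>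
      + 4 * G * (E \<omega> * growth p z (W \<omega>) + E \<omega> * growth p z (W' \<omega>)) \<partial>M)"
      using T_int Y(1) gr_E(1,3) integral_mult_growth_le(1)
      by (intro integral_mono T_le integrable_abs integrable_mult_right Bochner_Integration.integrable_add)
    also have "\<dots> = 2 * 2 powr p * G * a ^ 3 * (\<integral>\<omega>. (1 + \<bar>W \<omega>\<bar>) * growth p z (W \<omega>) \<partial>M) + (\<integral>\<omega>. Y \<omega> \<partial>M)
      + 4 * G * ((\<integral>\<omega>. E \<omega> * growth p z (W \<omega>) \<partial>M) + (\<integral>\<omega>. E \<omega> * growth p z (W' \<omega>) \<partial>M))"
      using Y(1) gr_E(1,3) integral_mult_growth_le(1)[of z] by simp
    also have "\<dots> \<le> 2 * 2 powr p * G * a ^ 3 * N + 8 * 3 powr p * a * N * (\<tau> + S') + 4 * G * (S'' * N + S'' * N)"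
      using a G gr_E(2,4) Y(2) integral_mult_growth_le(2)[of z]
      by (intro add_mono mult_left_mono) (auto simp: N_def)
    finally show ?thesis by (simp add: mult_ac)
  qed

  have "\<bar>\<integral>\<omega>. stein_rhs z (W \<omega>) \<partial>M\<bar> \<le> (\<integral>\<omega>. \<bar>V \<omega> * stein_deriv z (W \<omega>)\<bar> \<partial>M)
      + (\<integral>\<omega>. \<bar>T \<omega>\<bar> \<partial>M) / (2 * \<tau>) + (\<integral>\<omega>. \<bar>R \<omega> * stein_sol z (W \<omega>)\<bar> \<partial>M) / \<tau>"
  proof -
    have "\<bar>x - t / (2 * \<tau>) - r / \<tau>\<bar> \<le> A + B / (2 * \<tau>) + C / \<tau>"
      if "\<bar>x\<bar> \<le> A" "\<bar>t\<bar> \<le> B" "\<bar>r\<bar> \<le> C" for x t r A B C :: real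
    proof -
      have "\<bar>t / (2 * \<tau>)\<bar> \<le> B / (2 * \<tau>)" "\<bar>r / \<tau>\<bar> \<le> C / \<tau>"
        using that \<tau>_pos by (simp_all add: abs_divide divide_right_mono)
      thus ?thesis using that(1) unfolding abs_le_iff by linarith
    qed
    thus ?thesis unfolding error by (simp add: integral_abs_bound)
  qed
  also have "\<dots> \<le> S * (2 * G * N) + (2 * 2 powr p * G * a ^ 3 * N + 8 * 3 powr p * a * N * (\<tau> + S') + 8 * G * (S'' * N)) / (2 * \<tau>)
      + S' * (G * N) / \<tau>"
  proof (intro add_mono divide_right_mono T_bound)
    show "(\<integral>\<omega>. \<bar>V \<omega> * stein_deriv z (W \<omega>)\<bar> \<partial>M) \<le> S * (2 * G * N)"
      using deriv_V(2) by (simp add: S_def N_def mult.assoc)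
    show "(\<integral>\<omega>. \<bar>R \<omega> * stein_sol z (W \<omega>)\<bar> \<partial>M) \<le> S' * (G * N)"
      using sol_R(2) by (simp add: S'_def N_def mult.assoc)
  qed (use \<tau>_pos in auto)
  also have "\<dots> = N * (2 * G * S + 2 powr p * G * (a ^ 3 / \<tau>) + 4 * 3 powr p * a + (4 * 3 powr p * a + G) * (S' / \<tau>) + 4 * G * (S'' / \<tau>))"
    using \<tau>_pos by (simp add: field_simps)
  also have "\<dots> \<le> N * (4 * 3 powr p * G * S + 4 * 3 powr p * G * (a ^ 3 / \<tau>) + 4 * 3 powr p * G * a + 4 * 3 powr p * G * (S' / \<tau>) + 4 * 3 powr p * G * (S'' / \<tau>))"
  proof -
    have three: "1 \<le> (3::real) powr p" by (rule ge_one_powr_ge_zero) (use p in auto)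
    have G_le: "1 * G \<le> 3 powr p * G" using G three by (intro mult_right_mono) auto
    have G_le': "3 powr p * 2 \<le> 3 powr p * G" using G by (intro mult_left_mono) auto
    have "2 powr p \<le> (3::real) powr p" using p by (intro powr_mono2) auto
    hence "2 powr p * G \<le> 3 powr p * G" using G by (intro mult_right_mono) auto
    moreover have "3 powr p * a \<le> 3 powr p * 1" using a by (intro mult_left_mono) auto
    ultimately have coeffs: "2 * G \<le> 4 * 3 powr p * G" "2 powr p * G \<le> 4 * 3 powr p * G"
      "4 * 3 powr p \<le> 4 * 3 powr p * G" "4 * 3 powr p * a + G \<le> 4 * 3 powr p * G"
      "4 * G \<le> 4 * 3 powr p * G"
      using G G_le G_le' by linarith+
    show ?thesis
      using a S_nonneg \<tau>_pos
      by (intro mult_left_mono[OF _ N] add_mono coeffs[THEN mult_right_mono]) auto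
  qed
  also have "\<dots> = 4 * 3 powr p * gauss_const p * decay z * moment * (S + S' / \<tau> + a + a ^ 3 / \<tau> + S'' / \<tau>)"
    unfolding N_def G_def by algebra
  finally show ?thesis
    unfolding cdf_error_eq S_def S'_def S''_def E_sq V_def q_def unfolding \<Delta>_def .
qed

end

context linear_exchangeable_pair
begin

lemma nonuniform_berry_esseen:
  assumes a: "0 < a"
    and variance_term: "integrable M (\<lambda>\<omega>. (1 - 1 / (2 * \<tau>) * cond_exp_given M W (\<lambda>\<omega>. (W \<omega> - W' \<omega>)\<^sup>2) \<omega>)\<^sup>2)"
    and tail_term: "integrable M (\<lambda>\<omega>. (W \<omega> - W' \<omega>) ^ 4 * indicator {a<..} \<bar>W \<omega> - W' \<omega>\<bar>)"
  shows "\<bar>measure M {\<omega> \<in> space M. W \<omega> \<le> z} - Phi z\<bar> \<le> 4 * 3 powr p * gauss_const p * decay z * moment *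
    (sqrt (\<integral>\<omega>. (1 - 1 / (2 * \<tau>) * cond_exp_given M W (\<lambda>\<omega>. (W \<omega> - W' \<omega>)\<^sup>2) \<omega>)\<^sup>2 \<partial>M)
     + sqrt (\<integral>\<omega>. (R \<omega>)\<^sup>2 \<partial>M) / \<tau> + a + a ^ 3 / \<tau>
     + sqrt (\<integral>\<omega>. (W \<omega> - W' \<omega>) ^ 4 * indicator {a<..} \<bar>W \<omega> - W' \<omega>\<bar> \<partial>M) / \<tau>)"
    (is "_ \<le> ?K * (sqrt ?V + sqrt ?R / \<tau> + a + ?A + sqrt ?E / \<tau>)")
proof (cases "a \<le> 1")
  case False
  have "1 \<le> (3::real) powr p" by (rule ge_one_powr_ge_zero) (use p_ge_1 in auto)
  hence "1 * (gauss_const p * decay z * moment) \<le> (4 * 3 powr p) * (gauss_const p * decay z * moment)"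
    using gauss_const_ge[of p] moment_ge_1 by (intro mult_right_mono) auto
  moreover have "0 \<le> ?K"
    using gauss_const_ge[of p] moment_ge_1 by simp
  hence "?K * 1 \<le> ?K * (sqrt ?V + sqrt ?R / \<tau> + a + ?A + sqrt ?E / \<tau>)"
  proof (rule mult_left_mono[rotated])
    have "0 \<le> sqrt ?V" "0 \<le> sqrt ?R / \<tau>" "0 \<le> ?A" "0 \<le> sqrt ?E / \<tau>"
      using a \<tau>_pos by simp_all
    thus "1 \<le> sqrt ?V + sqrt ?R / \<tau> + a + ?A + sqrt ?E / \<tau>"
      using False by linarith
  qed
  ultimately show ?thesis
    using trivial_bound[of z] by (simp only: mult.assoc mult_1_right mult_1)
qed (rule small_step_bound[OF a _ variance_term tail_term])

end

section \<open>Moments with values in the extended half-line\<close>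

lemma ennreal_sqrt_eq_top_iff [simp]: "ennreal_sqrt x = \<top> \<longleftrightarrow> x = \<top>"
  by (simp add: ennreal_sqrt_def)

lemma ennreal_sqrt_ennreal [simp]: "0 \<le> x \<Longrightarrow> ennreal_sqrt (ennreal x) = ennreal (sqrt x)"
  by (simp add: ennreal_sqrt_def)

lemma integrable_of_nn_integral_not_top:
  fixes f :: "'a \<Rightarrow> real"
  assumes "(\<integral>\<^sup>+x. ennreal (f x) \<partial>M) \<noteq> \<top>" "f \<in> borel_measurable M" "\<And>x. 0 \<le> f x"
  shows "integrable M f"
  using assms by (intro integrableI_nonneg) (auto simp: top.not_eq_extremum)

lemma nonuniform_bound_on_constant:
  fixes M :: "'a measure"
  assumes p: "1 \<le> p"
  shows "nonuniform_bound_on p (4 powr p * (4 * 3 powr p * gauss_const p)) M"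
  unfolding nonuniform_bound_on_def
proof (intro allI impI)
  fix W W' R :: "'a \<Rightarrow> real" and r :: "real \<Rightarrow> real" and \<tau> a z :: real
  assume "prob_space M" and a: "0 < a" and exch: "exchangeable_pair M W W'" and \<tau>: "0 < \<tau>" "\<tau> < 1"
    and r: "r \<in> borel_measurable borel" and R_eq: "R = (\<lambda>\<omega>. r (W \<omega>))"
    and reg: "AE \<omega> in M. cond_exp_given M W W' \<omega> = (1 - \<tau>) * W \<omega> + R \<omega>"
  interpret prob_space M by fact
  define K where "K = 4 * 3 powr p * gauss_const p"
  define d where "d = (1 + \<bar>z\<bar>) powr p"
  define q where "q = cond_exp_given M W (\<lambda>\<omega>. (W \<omega> - W' \<omega>)\<^sup>2)"
  define X where "X = (\<lambda>\<omega>. \<bar>W \<omega>\<bar> powr (2 * p))"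
  define V where "V = (\<lambda>\<omega>. (1 - 1 / (2 * \<tau>) * q \<omega>)\<^sup>2)"
  define E where "E = (\<lambda>\<omega>. (W \<omega> - W' \<omega>) ^ 4 * indicator {a<..} \<bar>W \<omega> - W' \<omega>\<bar>)"
  have [measurable]: "W \<in> borel_measurable M" "W' \<in> borel_measurable M"
    using exch by (auto simp: exchangeable_pair_def)
  have [measurable]: "X \<in> borel_measurable M" "V \<in> borel_measurable M" "E \<in> borel_measurable M"
    "R \<in> borel_measurable M"
    unfolding X_def V_def E_def q_def cond_exp_given_def R_eq using r by measurable
  have nonneg: "0 \<le> X \<omega>" "0 \<le> V \<omega>" "0 \<le> E \<omega>" for \<omega>
    by (simp_all add: X_def V_def E_def)
  have K: "0 < K" unfolding K_def using gauss_const_ge[of p] by (simp add: less_le_trans[of 0 2])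
  have d: "0 < d" unfolding d_def by (simp add: add_pos_nonneg)
  define B where "B = exchangeable_bound M (4 powr p * K) p \<tau> W W' R a z"
  have ind: "indicator {\<omega>. a < \<bar>W \<omega> - W' \<omega>\<bar>} \<omega> = (indicator {a<..} \<bar>W \<omega> - W' \<omega>\<bar> :: real)" for \<omega>
    by (simp add: indicator_def)
  have B_eq: "B = ennreal (4 powr p * K) * (1 + (\<integral>\<^sup>+\<omega>. X \<omega> \<partial>M)) / ennreal d *
      (ennreal_sqrt (\<integral>\<^sup>+\<omega>. V \<omega> \<partial>M) + ennreal_sqrt (\<integral>\<^sup>+\<omega>. (R \<omega>)\<^sup>2 \<partial>M) / ennreal \<tau>
       + ennreal a + ennreal (a ^ 3 / \<tau>) + ennreal_sqrt (\<integral>\<^sup>+\<omega>. E \<omega> \<partial>M) / ennreal \<tau>)"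
    unfolding B_def exchangeable_bound_def Let_def X_def V_def E_def q_def d_def ind ..
  \<comment> \<open>The first factor of the bound is positive because of its summand \<open>1\<close>, the second because
    of \<open>a\<close>. Hence the bound is finite only if all moments in it are.\<close>
  have "ennreal \<bar>measure M {\<omega> \<in> space M. W \<omega> \<le> z} - Phi z\<bar> \<le> B"
  proof (cases "B = \<top>")
    case False
    have "(\<integral>\<^sup>+\<omega>. X \<omega> \<partial>M) \<noteq> \<top>"
      using False a d K unfolding B_eq
      by (auto simp: ennreal_mult_eq_top_iff ennreal_top_mult ennreal_mult_top ennreal_divide_eq_top_iff)
    moreover have "(\<integral>\<^sup>+\<omega>. V \<omega> \<partial>M) \<noteq> \<top>" "(\<integral>\<^sup>+\<omega>. (R \<omega>)\<^sup>2 \<partial>M) \<noteq> \<top>" "(\<integral>\<^sup>+\<omega>. E \<omega> \<partial>M) \<noteq> \<top>"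
      using False a d K \<tau> unfolding B_eq
      by (auto simp: ennreal_mult_eq_top_iff ennreal_divide_eq_top_iff)
    ultimately have int: "integrable M X" "integrable M V" "integrable M (\<lambda>\<omega>. (R \<omega>)\<^sup>2)" "integrable M E"
      by (auto intro!: integrable_of_nn_integral_not_top nonneg)
    have le: "(1 + \<bar>W \<omega>\<bar>) powr (2 * p) \<le> 4 powr p * (1 + X \<omega>)" for \<omega>
      unfolding X_def using p by (intro one_plus_powr_le) auto
    have int_bound: "integrable M (\<lambda>\<omega>. 4 powr p * (1 + X \<omega>))"
      using int(1) by simp
    have moment: "integrable M (\<lambda>\<omega>. (1 + \<bar>W \<omega>\<bar>) powr (2 * p))"
      by (rule Bochner_Integration.integrable_bound[OF int_bound])
        (use le nonneg(1) in \<open>auto simp: abs_of_nonneg\<close>)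
    interpret linear_exchangeable_pair M W W' R r \<tau> p
      by unfold_locales (fact exch \<tau>(1) p r R_eq reg moment int(3))+
    have "moment \<le> (\<integral>\<omega>. 4 powr p * (1 + X \<omega>) \<partial>M)"
      unfolding moment_def by (intro integral_mono moment int_bound le)
    also have "\<dots> = 4 powr p * (1 + (\<integral>\<omega>. X \<omega> \<partial>M))"
      using int(1) by (simp add: prob_space)
    finally have m: "moment \<le> 4 powr p * (1 + (\<integral>\<omega>. X \<omega> \<partial>M))" .
    define S where "S = sqrt (\<integral>\<omega>. V \<omega> \<partial>M) + sqrt (\<integral>\<omega>. (R \<omega>)\<^sup>2 \<partial>M) / \<tau> + a + a ^ 3 / \<tau> + sqrt (\<integral>\<omega>. E \<omega> \<partial>M) / \<tau>"
    have S: "0 \<le> S"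
      unfolding S_def using a \<tau> nonneg by (intro add_nonneg_nonneg divide_nonneg_nonneg) auto
    have "\<bar>measure M {\<omega> \<in> space M. W \<omega> \<le> z} - Phi z\<bar> \<le> K * decay z * moment * S"
      unfolding S_def K_def V_def E_def q_def
      by (rule nonuniform_berry_esseen[OF a int(2)[unfolded V_def q_def] int(4)[unfolded E_def]])
    also have "\<dots> \<le> K * decay z * (4 powr p * (1 + (\<integral>\<omega>. X \<omega> \<partial>M))) * S"
      using K by (intro mult_right_mono mult_left_mono m S) auto
    also have "\<dots> = 4 powr p * K * (1 + (\<integral>\<omega>. X \<omega> \<partial>M)) / d * S"
      by (simp add: d_def powr_minus_divide)
    finally have "ennreal \<bar>measure M {\<omega> \<in> space M. W \<omega> \<le> z} - Phi z\<bar>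
        \<le> ennreal (4 powr p * K * (1 + (\<integral>\<omega>. X \<omega> \<partial>M)) / d * S)"
      by (rule ennreal_leI)
    also have "\<dots> = ennreal (4 powr p * K) * (1 + ennreal (\<integral>\<omega>. X \<omega> \<partial>M)) / ennreal d * ennreal S"
      using K d S nonneg(1)
      by (subst ennreal_mult', simp, subst divide_ennreal[symmetric]) (simp_all add: ennreal_mult')
    also have "ennreal S = ennreal_sqrt (ennreal (\<integral>\<omega>. V \<omega> \<partial>M)) + ennreal_sqrt (ennreal (\<integral>\<omega>. (R \<omega>)\<^sup>2 \<partial>M)) / ennreal \<tau>
       + ennreal a + ennreal (a ^ 3 / \<tau>) + ennreal_sqrt (ennreal (\<integral>\<omega>. E \<omega> \<partial>M)) / ennreal \<tau>"
      unfolding S_def using a \<tau> nonneg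
      by (simp add: divide_ennreal integral_nonneg)
    also have "ennreal (4 powr p * K) * (1 + ennreal (\<integral>\<omega>. X \<omega> \<partial>M)) / ennreal d * \<dots> = B"
      unfolding B_eq using int nonneg by (simp add: nn_integral_eq_integral)
    finally show ?thesis .
  qed simp
  thus "ennreal \<bar>measure M {\<omega> \<in> space M. W \<omega> \<le> z} - Phi z\<bar>
      \<le> exchangeable_bound M (4 powr p * (4 * 3 powr p * gauss_const p)) p \<tau> W W' R a z"
    by (simp add: B_def K_def)
qed

section \<open>Transfer to the joint law\<close>

text \<open>
  Conditional expectations given \<open>g\<close> on the image space pull back to conditional expectations
  given \<open>g \<circ> T\<close>. The conditional expectation of a nonnegative function is determined by its integrals
  even if they are infinite; the real version below, a difference of two nonnegative ones, therefore
  covers every measurable \<open>f\<close>.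
\<close>

lemma nn_cond_exp_distr:
  fixes g :: "'b \<Rightarrow> real" and f :: "'b \<Rightarrow> ennreal"
  assumes "prob_space M" and [measurable]: "T \<in> measurable M N" "g \<in> borel_measurable N" "f \<in> borel_measurable N"
  shows "AE \<omega> in M. nn_cond_exp (distr M N T) (vimage_algebra (space N) g borel) f (T \<omega>) =
    nn_cond_exp M (vimage_algebra (space M) (\<lambda>\<omega>. g (T \<omega>)) borel) (\<lambda>\<omega>. f (T \<omega>)) \<omega>"
proof -
  let ?D = "distr M N T" and ?FM = "vimage_algebra (space M) (\<lambda>\<omega>. g (T \<omega>)) borel"
  let ?FN = "vimage_algebra (space N) g borel"
  let ?e = "nn_cond_exp ?D ?FN f"
  interpret M: prob_space M by fact
  interpret D: prob_space ?D by (rule M.prob_space_distr) measurable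
  interpret M: finite_measure_subalgebra M ?FM
    by unfold_locales (simp add: subalgebra_def sets_image_in_sets)
  interpret D: finite_measure_subalgebra ?D ?FN
    by unfold_locales (simp add: subalgebra_def sets_image_in_sets)
  have [measurable]: "?e \<in> borel_measurable N"
    using borel_measurable_nn_cond_exp2[of ?D ?FN f] by simp
  have T: "T \<in> measurable ?FM ?FN"
    by (intro measurable_vimage_algebra2 measurable_vimage_algebra1)
      (use measurable_space[OF assms(2)] in auto)
  show ?thesis
  proof (rule M.nn_cond_exp_charact)
    fix A assume "A \<in> sets ?FM"
    then obtain B where B[measurable]: "B \<in> sets borel" and A: "A = (\<lambda>\<omega>. g (T \<omega>)) -` B \<inter> space M"
      by (auto simp: sets_vimage_algebra2)
    have F: "(\<lambda>x. indicator B (g x) :: ennreal) \<in> borel_measurable ?FN"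
      by (rule measurable_compose[OF measurable_vimage_algebra1]) auto
    have "(\<integral>\<^sup>+\<omega>\<in>A. f (T \<omega>) \<partial>M) = (\<integral>\<^sup>+\<omega>. indicator B (g (T \<omega>)) * f (T \<omega>) \<partial>M)"
      by (intro nn_integral_cong) (auto simp: A indicator_def)
    also have "\<dots> = (\<integral>\<^sup>+x. indicator B (g x) * f x \<partial>?D)"
      by (rule nn_integral_distr[symmetric]) measurable
    also have "\<dots> = (\<integral>\<^sup>+x. indicator B (g x) * ?e x \<partial>?D)"
      by (rule D.nn_cond_exp_intg[symmetric, OF F]) measurable
    also have "\<dots> = (\<integral>\<^sup>+\<omega>. indicator B (g (T \<omega>)) * ?e (T \<omega>) \<partial>M)"
      by (rule nn_integral_distr) measurable
    also have "\<dots> = (\<integral>\<^sup>+\<omega>\<in>A. ?e (T \<omega>) \<partial>M)"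
      by (intro nn_integral_cong) (auto simp: A indicator_def)
    finally show "(\<integral>\<^sup>+\<omega>\<in>A. f (T \<omega>) \<partial>M) = (\<integral>\<^sup>+\<omega>\<in>A. ?e (T \<omega>) \<partial>M)" .
  qed (use measurable_compose[OF T borel_measurable_nn_cond_exp] in measurable)
qed

lemma cond_exp_given_distr:
  fixes f g :: "'b \<Rightarrow> real"
  assumes "prob_space M" and [measurable]: "T \<in> measurable M N" "g \<in> borel_measurable N" "f \<in> borel_measurable N"
  shows "AE \<omega> in M. cond_exp_given (distr M N T) g f (T \<omega>) =
    cond_exp_given M (\<lambda>\<omega>. g (T \<omega>)) (\<lambda>\<omega>. f (T \<omega>)) \<omega>"
  using nn_cond_exp_distr[OF assms(1-3), of "\<lambda>x. ennreal (f x)"]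
    nn_cond_exp_distr[OF assms(1-3), of "\<lambda>x. ennreal (- f x)"]
  by (auto simp: cond_exp_given_def real_cond_exp_def)

lemma nonuniform_bound_on_transfer:
  fixes M :: "'a measure"
  assumes joint: "\<And>N :: (real \<times> real) measure. nonuniform_bound_on p C N"
  shows "nonuniform_bound_on p C M"
  unfolding nonuniform_bound_on_def
proof (intro allI impI)
  fix W W' R :: "'a \<Rightarrow> real" and r :: "real \<Rightarrow> real" and \<tau> a z :: real
  assume "prob_space M" and a: "0 < a" and exch: "exchangeable_pair M W W'" and \<tau>: "0 < \<tau>" "\<tau> < 1"
    and r[measurable]: "r \<in> borel_measurable borel" and R_eq: "R = (\<lambda>\<omega>. r (W \<omega>))"
    and reg: "AE \<omega> in M. cond_exp_given M W W' \<omega> = (1 - \<tau>) * W \<omega> + R \<omega>"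
  interpret M: prob_space M by fact
  have W[measurable]: "W \<in> borel_measurable M" "W' \<in> borel_measurable M"
    using exch by (auto simp: exchangeable_pair_def)
  define T where "T = (\<lambda>\<omega>. (W \<omega>, W' \<omega>))"
  define N where "N = distr M (borel \<Otimes>\<^sub>M borel) T"
  have T[measurable]: "T \<in> measurable M (borel \<Otimes>\<^sub>M borel)" unfolding T_def by measurable
  have sets_N [measurable_cong]: "sets N = sets (borel \<Otimes>\<^sub>M borel)" by (simp add: N_def)
  have space_N: "space N = UNIV" by (simp add: N_def space_pair_measure)
  have cond: "AE \<omega> in M. cond_exp_given N fst f (T \<omega>) = cond_exp_given M W (\<lambda>\<omega>. f (W \<omega>, W' \<omega>)) \<omega>"
    if "f \<in> borel_measurable (borel \<Otimes>\<^sub>M borel)" for f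
    using cond_exp_given_distr[OF \<open>prob_space M\<close> T measurable_fst that] by (simp add: N_def T_def)
  have cond_measurable [measurable]: "cond_exp_given N fst f \<in> borel_measurable (borel \<Otimes>\<^sub>M borel)" for f
    using borel_measurable_cond_exp2[of N _ f] by (simp add: cond_exp_given_def sets_N cong: measurable_cong_sets)
  have "prob_space N"
    unfolding N_def by (rule M.prob_space_distr) measurable
  moreover have "exchangeable_pair N fst snd"
  proof -
    have "distr N (borel \<Otimes>\<^sub>M borel) (\<lambda>x. (fst x, snd x)) = distr M (borel \<Otimes>\<^sub>M borel) (\<lambda>\<omega>. (W \<omega>, W' \<omega>))"
      "distr N (borel \<Otimes>\<^sub>M borel) (\<lambda>x. (snd x, fst x)) = distr M (borel \<Otimes>\<^sub>M borel) (\<lambda>\<omega>. (W' \<omega>, W \<omega>))"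
      unfolding N_def by (subst distr_distr; simp add: T_def comp_def)+
    thus ?thesis
      using exch by (simp add: exchangeable_pair_def)
  qed
  moreover have "AE x in N. cond_exp_given N fst snd x = (1 - \<tau>) * fst x + r (fst x)"
    unfolding N_def
  proof (subst AE_distr_iff)
    show "AE \<omega> in M. cond_exp_given (distr M (borel \<Otimes>\<^sub>M borel) T) fst snd (T \<omega>) = (1 - \<tau>) * fst (T \<omega>) + r (fst (T \<omega>))"
      using reg cond[of snd] unfolding N_def by (auto simp: R_eq T_def)
  qed (use cond_measurable[of snd] in \<open>simp_all add: N_def[symmetric]\<close>)
  ultimately have "ennreal \<bar>measure N {x \<in> space N. fst x \<le> z} - Phi z\<bar>
      \<le> exchangeable_bound N C p \<tau> fst snd (\<lambda>x. r (fst x)) a z"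
    using joint[of N] a \<tau> r unfolding nonuniform_bound_on_def by blast
  moreover have "measure N {x \<in> space N. fst x \<le> z} = measure M {\<omega> \<in> space M. W \<omega> \<le> z}"
  proof -
    have "{x \<in> space N. fst x \<le> z} \<in> sets N" by measurable
    thus ?thesis
      unfolding N_def by (subst measure_distr)
        (auto simp: T_def space_pair_measure intro!: arg_cong[where f = "measure M"])
  qed
  moreover have "exchangeable_bound N C p \<tau> fst snd (\<lambda>x. r (fst x)) a z = exchangeable_bound M C p \<tau> W W' R a z"
  proof -
    have nn: "(\<integral>\<^sup>+x. h x \<partial>N) = (\<integral>\<^sup>+\<omega>. h (W \<omega>, W' \<omega>) \<partial>M)" if "h \<in> borel_measurable (borel \<Otimes>\<^sub>M borel)" for h
      unfolding N_def using that by (subst nn_integral_distr) (auto simp: T_def)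
    have "(\<integral>\<^sup>+x. ennreal ((1 - 1 / (2 * \<tau>) * cond_exp_given N fst (\<lambda>x. (fst x - snd x)\<^sup>2) x)\<^sup>2) \<partial>N) =
        (\<integral>\<^sup>+\<omega>. ennreal ((1 - 1 / (2 * \<tau>) * cond_exp_given M W (\<lambda>\<omega>. (W \<omega> - W' \<omega>)\<^sup>2) \<omega>)\<^sup>2) \<partial>M)"
      using cond[of "\<lambda>x. (fst x - snd x)\<^sup>2"]
      by (subst nn) (auto intro!: nn_integral_cong_AE simp: T_def)
    moreover have "(\<integral>\<^sup>+x. ennreal ((fst x - snd x) ^ 4 * indicator {x. \<bar>fst x - snd x\<bar> > a} x) \<partial>N) =
        (\<integral>\<^sup>+\<omega>. ennreal ((W \<omega> - W' \<omega>) ^ 4 * indicator {\<omega>. \<bar>W \<omega> - W' \<omega>\<bar> > a} \<omega>) \<partial>M)"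
    proof -
      have "(\<integral>\<^sup>+x. ennreal ((fst x - snd x) ^ 4 * indicator {x. \<bar>fst x - snd x\<bar> > a} x) \<partial>N) =
          (\<integral>\<^sup>+x. ennreal ((fst x - snd x) ^ 4 * indicator {a<..} \<bar>fst x - snd x\<bar>) \<partial>N)"
        by (intro nn_integral_cong) (simp add: indicator_def)
      also have "\<dots> = (\<integral>\<^sup>+\<omega>. ennreal ((W \<omega> - W' \<omega>) ^ 4 * indicator {a<..} \<bar>W \<omega> - W' \<omega>\<bar>) \<partial>M)"
        by (subst nn) auto
      also have "\<dots> = (\<integral>\<^sup>+\<omega>. ennreal ((W \<omega> - W' \<omega>) ^ 4 * indicator {\<omega>. \<bar>W \<omega> - W' \<omega>\<bar> > a} \<omega>) \<partial>M)"
        by (intro nn_integral_cong) (simp add: indicator_def)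
      finally show ?thesis .
    qed
    ultimately show ?thesis
      unfolding exchangeable_bound_def Let_def R_eq by (simp add: nn)
  qed
  ultimately show "ennreal \<bar>measure M {\<omega> \<in> space M. W \<omega> \<le> z} - Phi z\<bar> \<le> exchangeable_bound M C p \<tau> W W' R a z"
    by simp
qed

theorem theorem1p2:
  fixes p :: real
  assumes "p \<ge> 1"
  shows "(\<exists>C. universal_constant p C) \<and>
         (\<forall>C. universal_constant p C \<longrightarrow> (\<forall>M :: 'a measure. nonuniform_bound_on p C M))"
proof (intro conjI allI impI)
  have "0 < 4 powr p * (4 * 3 powr p * gauss_const p)"
    using gauss_const_ge[of p] by (simp add: less_le_trans[of 0 2])
  thus "\<exists>C. universal_constant p C"
    unfolding universal_constant_def using nonuniform_bound_on_constant[OF assms] by blast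
qed (auto simp: universal_constant_def intro: nonuniform_bound_on_transfer)

end
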